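(* Let $(c,h_U,h_W,e)$ be one of $$\Big(\tfrac12,\tfrac12,\tfrac1{16},1\Big),\quad \Big(\tfrac7{10},\tfrac1{10},\tfrac3{80},\tfrac15\Big),\quad \Big(\tfrac45,\tfrac25,\tfrac1{15},\tfrac45\Big),\quad \Big(\tfrac67,\tfrac17,\tfrac1{21},\tfrac27\Big),$$ and let $V=L(c,0)$, $U=L(c,h_U)$, $W=L(c,h_W)$. Let $I$ be a nonzero intertwining operator of type $\binom{W}{U\ \ W}$ and let $u$ be a lowest weight vector of $U$ (of weight $h_U$), normalized so that the coefficient of the leading term (lowest power of $q$) of $S^I(u,\tau)$ is one. Then $$S^I(u,\tau)=\eta(\tau)^{e},$$ i.e. the trace function equals $\eta(\tau)$, $\eta(\tau)^{1/5}$, $\eta(\tau)^{4/5}$, $\eta(\tau)^{2/7}$ respectively.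
   Context: $L(c,h)$ denotes the irreducible highest weight module of the Virasoro algebra with central charge $c$ and highest weight $h$ (i.e. lowest $L(0)$-eigenvalue $h$); for the given $c$, $L(c,0)$ is a rational vertex operator algebra and $L(c,h_U)$, $L(c,h_W)$ are irreducible $L(c,0)$-modules. An intertwining operator of type $\binom{W}{U\ W}$ is a linear map $w\mapsto I(w,z)=\sum_{r\in\mathbb C}w^I(r)z^{-r-1}$, $U\to\mathrm{Hom}(W,W)\{z\}$, such that for each $r\in\mathbb C$, $w^I(r+n)w_2=0$ for integers $n$ sufficiently large, $\frac{d}{dz}I(w,z)=I(L(-1)w,z)$, $(z-x)^N(Y^W(v,z)I(w,x)-I(w,x)Y^W(v,z))=0$ for $N\gg0$, and $I(v(n)w,z)=\mathrm{Res}_x\{(x-z)^nY^W(v,x)I(w,z)-(-z+x)^nI(w,z)Y^W(v,x)\}$ for $v\in V$, $n\in\mathbb Z$, where $Y^W(v,z)=\sum_n v(n)z^{-n-1}$ denotes the module vertex operator. For $u\in U$ of $L(0)$-weight $\mathrm{wt}(u)$, $o^I(u)=u^I(\mathrm{wt}(u)-1)$ is a grade-preserving operator on $W$, and $S^I(u,\tau)=\mathrm{tr}_{|W}\,o^I(u)q^{L(0)-c/24}$, with $q^{\lambda}=e^{2\pi i\lambda\tau}$, $\tau$ in the upper half-plane. $\eta(\tau)=q^{1/24}\prod_{n\ge1}(1-q^n)$ and $\eta(\tau)^{e}=q^{e/24}\prod_{n\ge1}(1-q^n)^{e}$. *)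

theory Defs
  imports "HOL-Analysis.Analysis" "HOL-Library.Groups_Big_Fun"
begin

section \<open>Representations of the Virasoro algebra\<close>

locale virasoro_module = vector_space smul
  for smul :: "complex \<Rightarrow> 'a::ab_group_add \<Rightarrow> 'a" +
  fixes c :: complex and L :: "int \<Rightarrow> 'a \<Rightarrow> 'a"
  assumes L_linear: "Vector_Spaces.linear smul smul (L n)"
    and L_commutator:
      "L m (L n x) - L n (L m x) =
         smul (of_int (m - n)) (L (m + n) x) +
         (if m + n = 0 then smul (of_int (m ^ 3 - m) / 12 * c) x else 0)"
begin

definition submodule :: "'a set \<Rightarrow> bool" where
  "submodule S \<longleftrightarrow> subspace S \<and> (\<forall>n. \<forall>x\<in>S. L n x \<in> S)"

end

text \<open>In the physics literature and in the theory of vertex operator algebras a ``highest weight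
  vector'' is at the same time a ``lowest weight vector'': it is annihilated by all \<open>L n\<close> with
  \<open>n > 0\<close>, and its weight is the lowest eigenvalue of \<open>L 0\<close> in the module it generates.\<close>

definition highest_weight_vector ::
  "(complex \<Rightarrow> 'a::ab_group_add \<Rightarrow> 'a) \<Rightarrow> complex \<Rightarrow> (int \<Rightarrow> 'a \<Rightarrow> 'a) \<Rightarrow> 'a \<Rightarrow> bool" where
  "highest_weight_vector smul h L x \<longleftrightarrow> x \<noteq> 0 \<and> L 0 x = smul h x \<and> (\<forall>n>0. L n x = 0)"

text \<open>The following predicate says that the representation is (isomorphic to) \<open>L(c,h)\<close>.\<close>

locale irreducible_highest_weight_module = virasoro_module smul c L
  for smul :: "complex \<Rightarrow> 'a::ab_group_add \<Rightarrow> 'a" and c h :: complex and L +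
  assumes generated: "\<exists>x. highest_weight_vector smul h L x \<and>
      (\<forall>S. submodule S \<and> x \<in> S \<longrightarrow> S = UNIV)"
    and irreducible: "submodule S \<Longrightarrow> S = {0} \<or> S = UNIV"


section \<open>Vertex operator algebras and their modules\<close>

text \<open>A vertex operator \<open>Y(v,z) = \<Sum>\<^sub>n v(n) z\<^sup>-\<^sup>n\<^sup>-\<^sup>1\<close> is represented by its modes: \<open>Y v n x = v(n)x\<close>.
  In particular \<open>Y(\<omega>,z) = \<Sum>\<^sub>n L(n) z\<^sup>-\<^sup>n\<^sup>-\<^sup>2\<close>, so \<open>L(n) = \<omega>(n+1)\<close>.\<close>

definition virasoro_mode :: "('v \<Rightarrow> int \<Rightarrow> 'a \<Rightarrow> 'a) \<Rightarrow> 'v \<Rightarrow> int \<Rightarrow> 'a \<Rightarrow> 'a" where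
  "virasoro_mode Y \<omega> n = Y \<omega> (n + 1)"

definition weight_space ::
  "(complex \<Rightarrow> 'a::ab_group_add \<Rightarrow> 'a) \<Rightarrow> (int \<Rightarrow> 'a \<Rightarrow> 'a) \<Rightarrow> complex \<Rightarrow> 'a set" where
  "weight_space smul L \<kappa> = {x. L 0 x = smul \<kappa> x}"

text \<open>The Jacobi identity in components (Borcherds identity). By the truncation property, which is
  always assumed with it, both sums have only finitely many nonzero terms.\<close>

definition borcherds_identity ::
  "(complex \<Rightarrow> 'a::ab_group_add \<Rightarrow> 'a) \<Rightarrow> ('v \<Rightarrow> int \<Rightarrow> 'v \<Rightarrow> 'v) \<Rightarrow> ('v \<Rightarrow> int \<Rightarrow> 'a \<Rightarrow> 'a) \<Rightarrow> bool" where
  "borcherds_identity smul Y YM \<longleftrightarrow> (\<forall>u v x l m n.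
     Sum_any (\<lambda>i::nat. smul (of_int m gchoose i) (YM (Y u (l + int i) v) (m + n - int i) x)) =
     Sum_any (\<lambda>i::nat. smul ((-1) ^ i * (of_int l gchoose i))
        (YM u (m + l - int i) (YM v (n + int i) x)
         - smul ((-1) powi l) (YM v (n + l - int i) (YM u (m + int i) x)))))"

locale vertex_operator_algebra = virasoro_module smul c "virasoro_mode Y \<omega>"
  for smul :: "complex \<Rightarrow> 'v::ab_group_add \<Rightarrow> 'v"
    and Y :: "'v \<Rightarrow> int \<Rightarrow> 'v \<Rightarrow> 'v" and vac \<omega> :: 'v and c :: complex +
  assumes Y_linear_left: "Vector_Spaces.linear smul smul (\<lambda>v. Y v n x)"
    and Y_linear_right: "Vector_Spaces.linear smul smul (Y v n)"
    and truncation: "\<exists>N. \<forall>n\<ge>N. Y u n v = 0"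
    and vacuum: "Y vac n v = (if n = -1 then v else 0)"
    and creation: "Y v (-1) vac = v" "n \<ge> 0 \<Longrightarrow> Y v n vac = 0"
    and borcherds: "borcherds_identity smul Y Y"
    and translation: "Y (virasoro_mode Y \<omega> (-1) v) n x = smul (- of_int n) (Y v (n - 1) x)"
    and grading: "span (\<Union>k::int. weight_space smul (virasoro_mode Y \<omega>) (of_int k)) = UNIV"
    and finite_dim: "\<exists>B. finite B \<and> weight_space smul (virasoro_mode Y \<omega>) (of_int k) \<subseteq> span B"
    and bounded_below: "\<exists>N. \<forall>k<N. weight_space smul (virasoro_mode Y \<omega>) (of_int k) = {0}"

locale voa_module =
  V: vertex_operator_algebra smul Y vac \<omega> c + M: vector_space smulM
  for smul :: "complex \<Rightarrow> 'v::ab_group_add \<Rightarrow> 'v"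
    and Y :: "'v \<Rightarrow> int \<Rightarrow> 'v \<Rightarrow> 'v" and vac \<omega> :: 'v and c :: complex
    and smulM :: "complex \<Rightarrow> 'm::ab_group_add \<Rightarrow> 'm" +
  fixes YM :: "'v \<Rightarrow> int \<Rightarrow> 'm \<Rightarrow> 'm"
  assumes YM_linear_left: "Vector_Spaces.linear smul smulM (\<lambda>v. YM v n x)"
    and YM_linear_right: "Vector_Spaces.linear smulM smulM (YM v n)"
    and YM_truncation: "\<exists>N. \<forall>n\<ge>N. YM v n x = 0"
    and YM_vacuum: "YM vac n x = (if n = -1 then x else 0)"
    and YM_borcherds: "borcherds_identity smulM Y YM"
    and YM_grading: "M.span (\<Union>\<kappa>. weight_space smulM (virasoro_mode YM \<omega>) \<kappa>) = UNIV"
    and YM_finite_dim: "\<exists>B. finite B \<and> weight_space smulM (virasoro_mode YM \<omega>) \<kappa> \<subseteq> M.span B"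
    and YM_bounded_below:
      "\<exists>N::int. \<forall>k<N. weight_space smulM (virasoro_mode YM \<omega>) (\<kappa> + of_int k) = {0}"


section \<open>Intertwining operators\<close>

text \<open>\<open>I w r x\<close> is \<open>w\<^sup>I(r)x\<close>, where \<open>I(w,z) = \<Sum>\<^sub>r w\<^sup>I(r) z\<^sup>-\<^sup>r\<^sup>-\<^sup>1\<close> with \<open>r\<close> ranging over the complex numbers.

  \<open>I_derivative\<close> is the coefficient of \<open>z\<^sup>-\<^sup>r\<^sup>-\<^sup>1\<close> in \<open>d/dz I(w,z) = I(L(-1)w,z)\<close>.

  \<open>I_locality\<close> is the coefficient of \<open>z\<^sup>-\<^sup>m\<^sup>-\<^sup>1 x\<^sup>-\<^sup>r\<^sup>-\<^sup>1\<close> in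
  \<open>(z-x)\<^sup>N (Y(v,z) I(w,x) - I(w,x) Y(v,z)) = 0\<close>, where \<open>N\<close> may depend on \<open>v\<close> and \<open>w\<close> only.

  \<open>I_iterate\<close> is the coefficient of \<open>z\<^sup>-\<^sup>r\<^sup>-\<^sup>1\<close> in
  \<open>I(v(n)w,z) = Res\<^sub>x {(x-z)\<^sup>n Y(v,x) I(w,z) - (-z+x)\<^sup>n I(w,z) Y(v,x)}\<close>, where \<open>(x-z)\<^sup>n\<close> is expanded in
  nonnegative powers of \<open>z\<close> and \<open>(-z+x)\<^sup>n\<close> in nonnegative powers of \<open>x\<close>. The sums over \<open>i\<close> have only
  finitely many nonzero terms by the truncation properties of \<open>I\<close> and \<open>YW\<close>.\<close>

locale intertwining_operator =
  U: voa_module smul Y vac \<omega> c smulU YU + W: voa_module smul Y vac \<omega> c smulW YW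
  for smul :: "complex \<Rightarrow> 'v::ab_group_add \<Rightarrow> 'v"
    and Y :: "'v \<Rightarrow> int \<Rightarrow> 'v \<Rightarrow> 'v" and vac \<omega> :: 'v and c :: complex
    and smulU :: "complex \<Rightarrow> 'u::ab_group_add \<Rightarrow> 'u" and YU :: "'v \<Rightarrow> int \<Rightarrow> 'u \<Rightarrow> 'u"
    and smulW :: "complex \<Rightarrow> 'w::ab_group_add \<Rightarrow> 'w" and YW :: "'v \<Rightarrow> int \<Rightarrow> 'w \<Rightarrow> 'w" +
  fixes I :: "'u \<Rightarrow> complex \<Rightarrow> 'w \<Rightarrow> 'w"
  assumes I_linear_left: "Vector_Spaces.linear smulU smulW (\<lambda>w. I w r x)"
    and I_linear_right: "Vector_Spaces.linear smulW smulW (I w r)"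
    and I_truncation: "\<exists>N::int. \<forall>n\<ge>N. I w (r + of_int n) x = 0"
    and I_derivative: "I (virasoro_mode YU \<omega> (-1) w) r x = smulW (- r) (I w (r - 1) x)"
    and I_locality: "\<exists>N0. \<forall>N\<ge>N0. \<forall>m r x.
      (\<Sum>i\<le>N. smulW ((-1) ^ i * of_nat (N choose i))
         (YW v (m + int N - int i) (I w (r + of_nat i) x)
          - I w (r + of_nat i) (YW v (m + int N - int i) x))) = 0"
    and I_iterate: "I (YU v n w) r x =
        Sum_any (\<lambda>i::nat. smulW ((of_int n gchoose i) * (-1) ^ i)
          (YW v (n - int i) (I w (r + of_nat i) x)))
      - Sum_any (\<lambda>i::nat. smulW ((of_int n gchoose i) * (-1) powi (n - int i))
          (I w (r + of_int n - of_nat i) (YW v (int i) x)))"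


section \<open>Trace functions\<close>

text \<open>The trace of \<open>f\<close> on a finite-dimensional invariant subspace \<open>S\<close>; it does not depend on the
  choice of the basis.\<close>

definition (in vector_space) trace_on :: "'b set \<Rightarrow> ('b \<Rightarrow> 'b) \<Rightarrow> 'a" where
  "trace_on S f =
     (let B = (SOME B. independent B \<and> span B = S) in \<Sum>b\<in>B. representation B (f b) b)"

definition weight ::
  "(complex \<Rightarrow> 'a::ab_group_add \<Rightarrow> 'a) \<Rightarrow> (int \<Rightarrow> 'a \<Rightarrow> 'a) \<Rightarrow> 'a \<Rightarrow> complex" where
  "weight smul L u = (THE \<kappa>. L 0 u = smul \<kappa> u)"

context intertwining_operator
begin

definition zero_mode :: "'u \<Rightarrow> 'w \<Rightarrow> 'w" where
  "zero_mode u = I u (weight smulU (virasoro_mode YU \<omega>) u - 1)"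

text \<open>The coefficient of \<open>q\<^bsup>\<kappa> - c/24\<^esup>\<close> in \<open>S\<^sup>I(u,\<tau>)\<close>.\<close>

definition trace_coeff :: "'u \<Rightarrow> complex \<Rightarrow> complex" where
  "trace_coeff u \<kappa> = W.M.trace_on (weight_space smulW (virasoro_mode YW \<omega>) \<kappa>) (zero_mode u)"

text \<open>\<open>trace_coeff u\<close> vanishes at every \<open>\<kappa>\<close> that is not an eigenvalue of \<open>L(0)\<close> on \<open>W\<close>, so the sum
  effectively runs over the weights of \<open>W\<close>. The value of \<open>infsum\<close> is 0 if there is no convergence.\<close>

definition trace_function :: "'u \<Rightarrow> complex \<Rightarrow> complex" where
  "trace_function u \<tau> =
     infsum (\<lambda>\<kappa>. trace_coeff u \<kappa> * exp (2 * of_real pi * \<i> * \<tau> * (\<kappa> - c / 24))) UNIV"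

definition leading_coeff_one :: "'u \<Rightarrow> bool" where
  "leading_coeff_one u \<longleftrightarrow>
     (\<exists>\<kappa>. trace_coeff u \<kappa> = 1 \<and> (\<forall>\<mu>. trace_coeff u \<mu> \<noteq> 0 \<longrightarrow> \<mu> = \<kappa> \<or> Re \<kappa> < Re \<mu>))"

end


section \<open>Powers of the Dedekind eta function\<close>

text \<open>As \<open>\<bar>q\<bar> < 1\<close> for \<open>\<tau>\<close> in the upper half-plane, each \<open>1 - q\<^sup>n\<close> has positive real part, and its
  principal power is the binomial series in \<open>q\<^sup>n\<close>.\<close>

definition eta_power :: "complex \<Rightarrow> complex \<Rightarrow> complex" where
  "eta_power e \<tau> = exp (2 * of_real pi * \<i> * \<tau> * (e / 24)) *
     prodinf (\<lambda>n. (1 - exp (2 * of_real pi * \<i> * \<tau> * of_nat (Suc n))) powr e)"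

end

theory Submission
  imports Defs "HOL-Complex_Analysis.Complex_Analysis"
begin

text \<open>In all four cases \<open>h = h\<^sub>U\<close> satisfies \<open>c (2h + 1) = 2h (5 - 8h)\<close> and \<open>e = 2h\<close>. Therefore the
  vector \<open>(L(-1)\<^sup>2 - t L(-2)) u\<close> with \<open>t = (4h + 2)/3\<close> is singular and vanishes in the irreducible
  module \<open>U\<close>. Its zero mode on \<open>W\<close> is a combination of products \<open>L(-k) X\<^sub>k\<close> and \<open>X\<^bsub>-k\<^esub> L(k)\<close> of Virasoro
  generators with modes of \<open>I(u,z)\<close>. By the cyclicity of the trace and the commutators \<open>[L(k), X\<^bsub>-k\<^esub>]\<close>,
  the traces of these products on weight spaces reduce to those of the zero mode of \<open>u\<close>. The
  coefficients \<open>T(\<kappa>)\<close> of the trace function thus satisfy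
  \<open>(\<kappa> - c/24 - h/12) T(\<kappa>) = - 2h \<Sum>\<^sub>n \<sigma>(n) T(\<kappa> - n)\<close>, where \<open>\<sigma>(n)\<close> is the sum of the divisors of \<open>n\<close>,
  which is the recursion for the coefficients of
  \<open>\<Prod>\<^sub>n (1 - q\<^sup>n)\<^sup>e = exp (- e \<Sum>\<^sub>n \<sigma>(n)/n q\<^sup>n)\<close>. No modular invariance is needed: the equation
  determines the trace function up to the factor that the normalization fixes.\<close>

section \<open>Traces on finite-dimensional subspaces\<close>

context vector_space
begin

definition finite_dim_subspace :: "'b set \<Rightarrow> bool" where
  "finite_dim_subspace S \<longleftrightarrow> subspace S \<and> (\<exists>B. finite B \<and> S \<subseteq> span B)"

text \<open>\<open>trace_on\<close> chooses its basis by \<open>SOME\<close>; fixing that choice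
  once, for all maps \<open>f\<close> on \<open>S\<close>, allows traces of different maps to be
  compared coordinatewise.\<close>

lemma trace_on_basis:
  assumes "local.finite_dim_subspace S"
  obtains B where "finite B" "independent B" "span B = S"
    "\<And>f. local.trace_on S f = (\<Sum>b\<in>B. representation B (f b) b)"
proof -
  define B where "B = (SOME B. independent B \<and> span B = S)"
  have S: "subspace S" using assms by (simp add: local.finite_dim_subspace_def)
  obtain B0 where "B0 \<subseteq> S" "independent B0" "S \<subseteq> span B0"
    using maximal_independent_subset by blast
  then have "independent B0 \<and> span B0 = S"
    using S span_minimal by blast
  then have B: "independent B \<and> span B = S"
    unfolding B_def by (rule someI)
  obtain C where "finite C" "S \<subseteq> span C"
    using assms by (auto simp: local.finite_dim_subspace_def)
  then have "finite B"
    using B independent_span_bound span_superset by (metis order_trans)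
  moreover have "local.trace_on S f = (\<Sum>b\<in>B. representation B (f b) b)" for f
    by (simp add: trace_on_def B_def Let_def)
  ultimately show ?thesis using that B by blast
qed

lemma trace_on_add:
  assumes "local.finite_dim_subspace S" "f ` S \<subseteq> S" "g ` S \<subseteq> S"
  shows "local.trace_on S (\<lambda>x. f x + g x) = local.trace_on S f + local.trace_on S g"
proof -
  obtain B where B: "finite B" "independent B" "span B = S"
    "\<And>f. local.trace_on S f = (\<Sum>b\<in>B. representation B (f b) b)"
    using trace_on_basis[OF assms(1)] by metis
  have "f b \<in> span B" "g b \<in> span B" if "b \<in> B" for b
    using that assms(2,3) B(3) span_base by blast+
  then show ?thesis
    using B(2) by (simp add: B(4) representation_add sum.distrib)
qed

lemma trace_on_scale:
  assumes "local.finite_dim_subspace S" "f ` S \<subseteq> S"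
  shows "local.trace_on S (\<lambda>x. scale a (f x)) = a * local.trace_on S f"
proof -
  obtain B where B: "finite B" "independent B" "span B = S"
    "\<And>f. local.trace_on S f = (\<Sum>b\<in>B. representation B (f b) b)"
    using trace_on_basis[OF assms(1)] by metis
  have "f b \<in> span B" if "b \<in> B" for b
    using that assms(2) B(3) span_base by blast
  then show ?thesis
    using B(2) by (simp add: B(4) representation_scale sum_distrib_left)
qed

lemma trace_on_cong:
  assumes "local.finite_dim_subspace S" "\<And>x. x \<in> S \<Longrightarrow> f x = g x"
  shows "local.trace_on S f = local.trace_on S g"
proof -
  obtain B where B: "finite B" "independent B" "span B = S"
    "\<And>f. local.trace_on S f = (\<Sum>b\<in>B. representation B (f b) b)"
    using trace_on_basis[OF assms(1)] by metis
  have "f b = g b" if "b \<in> B" for b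
    using that assms(2) B(3) span_base by blast
  then show ?thesis by (simp add: B(4))
qed

lemma trace_on_zero_map:
  assumes "local.finite_dim_subspace S"
  shows "local.trace_on S (\<lambda>x. 0) = 0"
proof -
  obtain B where B: "finite B" "independent B" "span B = S"
    "\<And>f. local.trace_on S f = (\<Sum>b\<in>B. representation B (f b) b)"
    using trace_on_basis[OF assms(1)] by metis
  show ?thesis by (simp add: B(4) representation_zero)
qed

lemma trace_on_zero_space: "local.trace_on {0} f = 0"
proof -
  have fin: "local.finite_dim_subspace {0}"
    unfolding local.finite_dim_subspace_def using span_zero by (auto simp: subspace_def)
  obtain B where B: "finite B" "independent B" "span B = {0}"
    "\<And>f. local.trace_on {0} f = (\<Sum>b\<in>B. representation B (f b) b)"
    using trace_on_basis[OF fin] by metis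
  have "B \<subseteq> {0}" using span_superset[of B] by (simp add: B(3))
  moreover have "0 \<notin> B" using B(2) dependent_zero by metis
  ultimately have "B = {}" by blast
  then show ?thesis by (simp add: B(4))
qed

lemma trace_on_sum:
  assumes "local.finite_dim_subspace S" "finite A" "\<And>i. i \<in> A \<Longrightarrow> f i ` S \<subseteq> S"
  shows "local.trace_on S (\<lambda>x. \<Sum>i\<in>A. f i x) = (\<Sum>i\<in>A. local.trace_on S (f i))"
  using assms(2,3)
proof (induction A rule: finite_induct)
  case empty
  then show ?case using trace_on_zero_map assms(1) by simp
next
  case (insert a A)
  have S: "subspace S" using assms(1) by (simp add: local.finite_dim_subspace_def)
  have "(\<lambda>x. \<Sum>i\<in>A. f i x) ` S \<subseteq> S"
    using insert.prems by (auto intro!: subspace_sum[OF S])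
  then show ?case
    using insert trace_on_add[OF assms(1), of "f a" "\<lambda>x. \<Sum>i\<in>A. f i x"] by simp
qed

text \<open>Both sides are one double sum of products of matrix entries, taken in two orders. The
  maps may run between different subspaces, as modes that shift the weight do.\<close>

lemma trace_on_commute:
  assumes S: "local.finite_dim_subspace S" and S': "local.finite_dim_subspace S'"
    and f: "Vector_Spaces.linear scale scale f" "f ` S \<subseteq> S'"
    and g: "Vector_Spaces.linear scale scale g" "g ` S' \<subseteq> S"
  shows "local.trace_on S (\<lambda>x. g (f x)) = local.trace_on S' (\<lambda>x. f (g x))"
proof -
  obtain B where B: "finite B" "independent B" "span B = S"
    "\<And>f. local.trace_on S f = (\<Sum>b\<in>B. representation B (f b) b)"
    using trace_on_basis[OF S] by metis
  obtain B' where B': "finite B'" "independent B'" "span B' = S'"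
    "\<And>f. local.trace_on S' f = (\<Sum>b\<in>B'. representation B' (f b) b)"
    using trace_on_basis[OF S'] by metis
  \<comment> \<open>The entry formula for a matrix product, stated for general bases so that it
    serves both sides.\<close>
  have expand: "representation C (k (l b)) b =
      (\<Sum>b'\<in>C'. representation C' (l b) b' * representation C (k b') b)"
    if "finite C'" "independent C'" "independent C" "Vector_Spaces.linear scale scale k"
      "k ` span C' \<subseteq> span C" "l b \<in> span C'" for C C' k l b
  proof -
    interpret k: Vector_Spaces.linear scale scale k by (fact that(4))
    have "l b = (\<Sum>b'\<in>C'. scale (representation C' (l b) b') b')"
      using that by (simp add: sum_representation_eq)
    then have "k (l b) = k (\<Sum>b'\<in>C'. scale (representation C' (l b) b') b')"
      by simp
    also have "\<dots> = (\<Sum>b'\<in>C'. scale (representation C' (l b) b') (k b'))"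
      by (simp add: k.sum k.scale)
    finally have "representation C (k (l b)) b =
        representation C (\<Sum>b'\<in>C'. scale (representation C' (l b) b') (k b')) b"
      by simp
    moreover have "k b' \<in> span C" if "b' \<in> C'" for b'
      using \<open>k ` span C' \<subseteq> span C\<close> that span_base by blast
    ultimately show ?thesis
      using that(3) by (simp add: representation_sum span_scale representation_scale)
  qed
  have "local.trace_on S (\<lambda>x. g (f x)) =
      (\<Sum>b\<in>B. \<Sum>b'\<in>B'. representation B' (f b) b' * representation B (g b') b)"
    unfolding B(4) using B B' f g span_base
    by (intro sum.cong refl expand) (auto simp: image_subset_iff)
  also have "\<dots> = (\<Sum>b'\<in>B'. \<Sum>b\<in>B. representation B (g b') b * representation B' (f b) b')"
    by (subst sum.swap) (simp add: mult.commute)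
  also have "\<dots> = local.trace_on S' (\<lambda>x. f (g x))"
    unfolding B'(4) using B B' f g span_base
    by (intro sum.cong refl expand[symmetric]) (auto simp: image_subset_iff)
  finally show ?thesis .
qed

end

section \<open>Trace recursion for a primary field with a level-two null vector\<close>

definition divisor_sum :: "nat \<Rightarrow> nat" where
  "divisor_sum n = \<Sum>{d. d dvd n}"

text \<open>Collecting the terms with j * k = n leaves the sum of all divisors k of n. Products
  above K contribute nothing, and M >= K ensures that every divisor of an n <= K occurs.\<close>

lemma sum_multiples_eq_divisor_sum:
  fixes f :: "nat \<Rightarrow> 'a::comm_semiring_1"
  assumes "\<And>n. n > K \<Longrightarrow> f n = 0" "M \<ge> K"
  shows "(\<Sum>k=1..M. \<Sum>j=1..K. of_nat k * f (j * k)) = (\<Sum>n=1..K. of_nat (divisor_sum n) * f n)"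
proof -
  have inner: "(\<Sum>j=1..K. of_nat k * f (j * k)) = (\<Sum>n=1..K. if k dvd n then of_nat k * f n else 0)"
    if "k \<in> {1..M}" for k
  proof -
    have "(\<Sum>j=1..K. of_nat k * f (j * k)) = (\<Sum>n\<in>(\<lambda>j. j * k) ` {1..K}. of_nat k * f n)"
      using that by (subst sum.reindex) (auto simp: inj_on_def)
    also have "\<dots> = (\<Sum>n | n \<in> {1..K} \<and> k dvd n. of_nat k * f n)"
    proof (rule sum.mono_neutral_right)
      show "{n \<in> {1..K}. k dvd n} \<subseteq> (\<lambda>j. j * k) ` {1..K}"
      proof
        fix n assume n: "n \<in> {n \<in> {1..K}. k dvd n}"
        then obtain j where j: "n = j * k" by (metis dvd_def mem_Collect_eq mult.commute)
        have "j * 1 \<le> j * k" using that by (intro mult_le_mono) auto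
        also have "j * k \<le> K" using n j by auto
        finally have "j \<le> K" by simp
        then show "n \<in> (\<lambda>j. j * k) ` {1..K}" using n j by (intro image_eqI[of _ _ j]) (auto intro: Suc_leI Nat.gr0I)
      qed
      have "of_nat k * f n = 0" if "n > K \<or> n = 0" "n \<in> (\<lambda>j. j * k) ` {1..K}" for n
        using that assms(1)[of n] \<open>k \<in> {1..M}\<close> by auto
      then show "\<forall>n\<in>(\<lambda>j. j * k) ` {1..K} - {n \<in> {1..K}. k dvd n}. of_nat k * f n = 0"
        by (metis (mono_tags, lifting) Diff_iff Suc_leI atLeastAtMost_iff dvd_triv_right gr0I imageE mem_Collect_eq not_le One_nat_def)
    qed simp
    also have "\<dots> = (\<Sum>n=1..K. if k dvd n then of_nat k * f n else 0)"
      by (simp only: sum.inter_filter[symmetric] finite_atLeastAtMost)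
    finally show ?thesis .
  qed
  have "(\<Sum>k=1..M. \<Sum>j=1..K. of_nat k * f (j * k)) =
      (\<Sum>n=1..K. \<Sum>k=1..M. if k dvd n then of_nat k * f n else 0)"
    by (subst (2) sum.swap) (rule sum.cong[OF refl inner])
  also have "\<dots> = (\<Sum>n=1..K. of_nat (divisor_sum n) * f n)"
  proof (rule sum.cong[OF refl])
    fix n assume n: "n \<in> {1..K}"
    have *: "{d. d dvd n} = {k \<in> {1..M}. k dvd n}"
      using n assms(2) by (auto dest: dvd_imp_le intro: Suc_leI dvd_pos_nat)
    show "(\<Sum>k=1..M. if k dvd n then of_nat k * f n else 0) = of_nat (divisor_sum n) * f n"
      unfolding divisor_sum_def * by (simp add: sum.inter_filter[symmetric] sum_distrib_right)
  qed
  finally show ?thesis .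
qed

text \<open>\<open>X n\<close> is the mode of a primary field of weight \<open>h\<close> that lowers the weight by \<open>n\<close>;
  for an intertwining operator it is \<open>u\<^sup>I(h - 1 + n)\<close>.\<close>

locale primary_field = virasoro_module smul c L
  for smul :: "complex \<Rightarrow> 'a::ab_group_add \<Rightarrow> 'a" and c L +
  fixes h :: complex and X :: "int \<Rightarrow> 'a \<Rightarrow> 'a"
  assumes X_linear: "Vector_Spaces.linear smul smul (X n)"
    and L_X: "L m (X n x) = X n (L m x) + smul (of_int m * (h - 1) - of_int n) (X (m + n) x)"
    and finite_dim: "\<exists>B. finite B \<and> weight_space smul L \<kappa> \<subseteq> span B"
    and bounded_below: "\<exists>N::int. \<forall>k<N. weight_space smul L (\<kappa> + of_int k) = {0}"
begin

abbreviation E :: "complex \<Rightarrow> 'a set" where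
  "E \<equiv> weight_space smul L"

definition T :: "complex \<Rightarrow> complex" where
  "T \<kappa> = local.trace_on (E \<kappa>) (X 0)"

sublocale L: Vector_Spaces.linear smul smul "L n" for n
  by (rule L_linear)

sublocale X: Vector_Spaces.linear smul smul "X n" for n
  by (rule X_linear)

section \<open>Weight shifts of the modes and reduction of the traces\<close>

lemma E_fin: "finite_dim_subspace (E \<kappa>)"
  unfolding finite_dim_subspace_def subspace_def
  using finite_dim
  by (auto simp: weight_space_def L.zero L.add L.scale scale_right_distrib mult.commute)

lemma L_E: "x \<in> E \<kappa> \<Longrightarrow> L k x \<in> E (\<kappa> - of_int k)"
  using L_commutator[of 0 k x]
  by (cases "k = 0") (auto simp: weight_space_def L.scale algebra_simps)

lemma X_E: "x \<in> E \<kappa> \<Longrightarrow> X k x \<in> E (\<kappa> - of_int k)"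
  using L_X[of 0 k x] by (auto simp: weight_space_def X.scale algebra_simps)

lemma LX_E: "x \<in> E \<kappa> \<Longrightarrow> L (-k) (X k x) \<in> E \<kappa>"
  using L_E[of "X k x" "\<kappa> - of_int k" "-k"] X_E[of x \<kappa> k] by simp

lemma XL_E: "x \<in> E \<kappa> \<Longrightarrow> X (-k) (L k x) \<in> E \<kappa>"
  using X_E[of "L k x" "\<kappa> - of_int k" "-k"] L_E[of x \<kappa> k] by simp

lemma X0_E: "x \<in> E \<kappa> \<Longrightarrow> X 0 x \<in> E \<kappa>"
  using X_E[of x \<kappa> 0] by simp

lemma scale_E: "x \<in> E \<kappa> \<Longrightarrow> smul a x \<in> E \<kappa>"
  by (auto simp: weight_space_def L.scale algebra_simps)

lemma L_X_opposite: "L k (X (-k) x) = X (-k) (L k x) + smul (of_int k * h) (X 0 x)"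
proof -
  have "of_int k * (h - 1) - of_int (-k) = of_int k * h"
    by (simp add: right_diff_distrib)
  then show ?thesis using L_X[of k "-k" x] by simp
qed

lemma X_L_opposite: "X k (L (-k) x) = L (-k) (X k x) + smul (of_int k * h) (X 0 x)"
proof -
  have "of_int (-k) * (h - 1) - of_int k = - (of_int k * h)"
    by (simp add: right_diff_distrib)
  then show ?thesis using L_X[of "-k" k x] by simp
qed

text \<open>Cyclicity through \<open>L k\<close> moves the trace from weight \<kappa> to \<kappa> -
  k with the factors in the opposite order; restoring the order costs the commutator, a multiple of
  \<open>X 0\<close>.\<close>

lemma trace_shift_XL:
  "local.trace_on (E \<kappa>) (\<lambda>x. X (-k) (L k x)) =
   local.trace_on (E (\<kappa> - of_int k)) (\<lambda>x. X (-k) (L k x)) + of_int k * h * T (\<kappa> - of_int k)"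
proof -
  have S: "(\<lambda>x. X (-k) (L k x)) ` E \<mu> \<subseteq> E \<mu>" "(\<lambda>x. smul (of_int k * h) (X 0 x)) ` E \<mu> \<subseteq> E \<mu>"
    "X 0 ` E \<mu> \<subseteq> E \<mu>" for \<mu>
    using XL_E X0_E scale_E by auto
  have "local.trace_on (E \<kappa>) (\<lambda>x. X (-k) (L k x)) =
      local.trace_on (E (\<kappa> - of_int k)) (\<lambda>x. L k (X (-k) x))"
    using X_E[of _ "\<kappa> - of_int k" "-k"]
    by (intro trace_on_commute[where f = "L k" and g = "X (-k)"] E_fin L_linear X_linear) (auto intro: L_E)
  also have "\<dots> = local.trace_on (E (\<kappa> - of_int k)) (\<lambda>x. X (-k) (L k x) + smul (of_int k * h) (X 0 x))"
    by (simp only: L_X_opposite)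
  also have "\<dots> = local.trace_on (E (\<kappa> - of_int k)) (\<lambda>x. X (-k) (L k x)) + of_int k * h * T (\<kappa> - of_int k)"
    unfolding T_def
    by (simp only: trace_on_add[OF E_fin S(1,2)] trace_on_scale[OF E_fin S(3)])
  finally show ?thesis .
qed

lemma trace_shift_LX:
  "local.trace_on (E \<kappa>) (\<lambda>x. L (-k) (X k x)) =
   local.trace_on (E (\<kappa> - of_int k)) (\<lambda>x. L (-k) (X k x)) + of_int k * h * T (\<kappa> - of_int k)"
proof -
  have S: "(\<lambda>x. L (-k) (X k x)) ` E \<mu> \<subseteq> E \<mu>" "(\<lambda>x. smul (of_int k * h) (X 0 x)) ` E \<mu> \<subseteq> E \<mu>"
    "X 0 ` E \<mu> \<subseteq> E \<mu>" for \<mu>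
    using LX_E X0_E scale_E by auto
  have "local.trace_on (E \<kappa>) (\<lambda>x. L (-k) (X k x)) =
      local.trace_on (E (\<kappa> - of_int k)) (\<lambda>x. X k (L (-k) x))"
    using L_E[of _ "\<kappa> - of_int k" "-k"]
    by (intro trace_on_commute[where f = "X k" and g = "L (-k)"] E_fin L_linear X_linear) (auto intro: X_E)
  also have "\<dots> = local.trace_on (E (\<kappa> - of_int k)) (\<lambda>x. L (-k) (X k x) + smul (of_int k * h) (X 0 x))"
    by (simp only: X_L_opposite)
  also have "\<dots> = local.trace_on (E (\<kappa> - of_int k)) (\<lambda>x. L (-k) (X k x)) + of_int k * h * T (\<kappa> - of_int k)"
    unfolding T_def
    by (simp only: trace_on_add[OF E_fin S(1,2)] trace_on_scale[OF E_fin S(3)])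
  finally show ?thesis .
qed

lemma telescope:
  fixes A :: "complex \<Rightarrow> complex" and k :: nat
  assumes "\<And>\<kappa>. A \<kappa> = A (\<kappa> - of_nat k) + f (\<kappa> - of_nat k)"
  shows "A \<kappa> = A (\<kappa> - of_nat (m * k)) + (\<Sum>j=1..m. f (\<kappa> - of_nat (j * k)))"
proof (induction m)
  case (Suc m)
  then show ?case using assms[of "\<kappa> - of_nat (m * k)"] by (simp add: algebra_simps)
qed simp

text \<open>K shifts by k >= 1 lower the weight by K * k >= K, into a zero space, so only the
  commutator terms remain. Both orderings give the same value because they satisfy the same shift
  equation.\<close>

lemma
  assumes K: "\<And>n. n \<ge> K \<Longrightarrow> E (\<kappa> - of_nat n) = {0}" and k: "k > 0"
  shows trace_XL: "local.trace_on (E \<kappa>) (\<lambda>x. X (- int k) (L (int k) x)) =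
      h * (\<Sum>j=1..K. of_nat k * T (\<kappa> - of_nat (j * k)))"
    and trace_LX: "local.trace_on (E \<kappa>) (\<lambda>x. L (- int k) (X (int k) x)) =
      h * (\<Sum>j=1..K. of_nat k * T (\<kappa> - of_nat (j * k)))"
proof -
  have z: "E (\<kappa> - of_nat (K * k)) = {0}"
    using k by (intro K) auto
  show "local.trace_on (E \<kappa>) (\<lambda>x. X (- int k) (L (int k) x)) =
      h * (\<Sum>j=1..K. of_nat k * T (\<kappa> - of_nat (j * k)))"
    (is "?A \<kappa> = _")
  proof -
    have step: "?A \<mu> = ?A (\<mu> - of_nat k) + of_nat k * h * T (\<mu> - of_nat k)" for \<mu>
      using trace_shift_XL[of \<mu> "int k"] by simp
    have "?A \<kappa> = ?A (\<kappa> - of_nat (K * k)) + (\<Sum>j=1..K. of_nat k * h * T (\<kappa> - of_nat (j * k)))"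
      by (rule telescope[where A = ?A]) (rule step)
    also have "?A (\<kappa> - of_nat (K * k)) = 0"
      unfolding z by (rule trace_on_zero_space)
    finally show ?thesis by (simp only: sum_distrib_left mult_ac add_0_left)
  qed
  show "local.trace_on (E \<kappa>) (\<lambda>x. L (- int k) (X (int k) x)) =
      h * (\<Sum>j=1..K. of_nat k * T (\<kappa> - of_nat (j * k)))"
    (is "?A \<kappa> = _")
  proof -
    have step: "?A \<mu> = ?A (\<mu> - of_nat k) + of_nat k * h * T (\<mu> - of_nat k)" for \<mu>
      using trace_shift_LX[of \<mu> "int k"] by simp
    have "?A \<kappa> = ?A (\<kappa> - of_nat (K * k)) + (\<Sum>j=1..K. of_nat k * h * T (\<kappa> - of_nat (j * k)))"
      by (rule telescope[where A = ?A]) (rule step)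
    also have "?A (\<kappa> - of_nat (K * k)) = 0"
      unfolding z by (rule trace_on_zero_space)
    finally show ?thesis by (simp only: sum_distrib_left mult_ac add_0_left)
  qed
qed

lemma vanishing_below:
  obtains K where "\<And>n. n \<ge> K \<Longrightarrow> E (\<kappa> - of_nat n) = {0}"
proof -
  obtain N :: int where N: "\<And>k. k < N \<Longrightarrow> E (\<kappa> + of_int k) = {0}"
    using bounded_below by blast
  have "E (\<kappa> - of_nat n) = {0}" if "n \<ge> nat (1 - N)" for n
    using N[of "- int n"] that by simp
  then show ?thesis using that by blast
qed

text \<open>Take the trace of the null vector equation on \<open>E \<kappa>\<close>. Both completed
  sums have the same trace, hence the factor 2; the completion adds h and the \<open>L 0\<close>
  term adds \<kappa> to the coefficient of \<open>T \<kappa>\<close>.\<close>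

lemma trace_recursion:
  assumes null: "\<And>x. smul (h * (h + 1)) (X 0 x) =
      smul t (Sum_any (\<lambda>i::nat. L (-2 - int i) (X (2 + int i) x)) +
              Sum_any (\<lambda>i::nat. X (1 - int i) (L (int i - 1) x)))"
    and K: "\<And>n. n \<ge> K \<Longrightarrow> E (\<kappa> - of_nat n) = {0}"
  shows "(h * (h + 1) - t * (h + \<kappa>)) * T \<kappa> =
    2 * h * t * (\<Sum>n=1..K. of_nat (divisor_sum n) * T (\<kappa> - of_nat n))"
proof -
  define A where "A = (\<lambda>k x. L (- int k) (X (int k) x))"
  define B where "B = (\<lambda>k x. X (- int k) (L (int k) x))"
  have A_E: "A k ` E \<kappa> \<subseteq> E \<kappa>" and B_E: "B k ` E \<kappa> \<subseteq> E \<kappa>" for k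
    unfolding A_def B_def using LX_E XL_E by auto
  have sub: "subspace (E \<kappa>)" using E_fin by (simp add: finite_dim_subspace_def)
  \<comment> \<open>The two infinite sums of the null vector equation are completed to sums over all \<open>k \<ge> 1\<close>
    by the term \<open>k = 1\<close>, which comes from commuting \<open>X 1\<close> past \<open>L (-1)\<close>.\<close>
  have reduced: "smul (h * (h + 1)) (X 0 x) =
      smul t ((\<Sum>k=1..Suc K. A k x) + (\<Sum>k=1..Suc K. B k x)) + smul (t * (h + \<kappa>)) (X 0 x)"
    if x: "x \<in> E \<kappa>" for x
  proof -
    have "Sum_any (\<lambda>i::nat. L (-2 - int i) (X (2 + int i) x)) = (\<Sum>i<K. L (-2 - int i) (X (2 + int i) x))"
    proof (rule Sum_any.expand_superset)
      have "i < K" if "L (-2 - int i) (X (2 + int i) x) \<noteq> 0" for i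
      proof (rule ccontr)
        assume "\<not> i < K"
        then have "X (2 + int i) x = 0"
          using X_E[OF x, of "2 + int i"] K[of "2 + i"] by simp
        with that show False by (simp add: L.zero)
      qed
      then show "{i. L (-2 - int i) (X (2 + int i) x) \<noteq> 0} \<subseteq> {..<K}"
        by auto
    qed simp
    also have "\<dots> = (\<Sum>k=1..Suc K. A k x) - L (-1) (X 1 x)"
      unfolding A_def
      by (simp only: sum.atLeast_Suc_atMost[of 1 "Suc K"])
        (auto intro!: sum.reindex_bij_witness[of _ "\<lambda>k. k - 2" "\<lambda>k. k + 2"] simp: numeral_2_eq_2 simp del: sum.cl_ivl_Suc)
    finally have 1: "Sum_any (\<lambda>i::nat. L (-2 - int i) (X (2 + int i) x)) = (\<Sum>k=1..Suc K. A k x) - L (-1) (X 1 x)" .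
    \<comment> \<open>The terms vanish from i = K + 1 on; the bound K + 2 lets k = i - 1 end at
      \<open>Suc K\<close>, as in the first sum.\<close>
    have "Sum_any (\<lambda>i::nat. X (1 - int i) (L (int i - 1) x)) = (\<Sum>i\<le>K + 2. X (1 - int i) (L (int i - 1) x))"
    proof (rule Sum_any.expand_superset)
      have "i \<le> K + 2" if "X (1 - int i) (L (int i - 1) x) \<noteq> 0" for i
      proof (rule ccontr)
        assume i: "\<not> i \<le> K + 2"
        then have "E (\<kappa> - of_nat (i - 1)) = {0}" by (intro K) simp
        then have "L (int i - 1) x = 0"
          using L_E[OF x, of "int i - 1"] i by (simp add: of_nat_diff)
        with that show False by (simp add: X.zero)
      qed
      then show "{i. X (1 - int i) (L (int i - 1) x) \<noteq> 0} \<subseteq> {..K + 2}"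
        by auto
    qed simp
    also have "{..K + 2} = {0, 1} \<union> {2..K + 2}" by auto
    also have "(\<Sum>i\<in>{0, 1} \<union> {2..K + 2}. X (1 - int i) (L (int i - 1) x)) =
        X 1 (L (-1) x) + X 0 (L 0 x) + (\<Sum>i=2..K + 2. X (1 - int i) (L (int i - 1) x))"
      by (subst sum.union_disjoint) auto
    also have "(\<Sum>i=2..K + 2. X (1 - int i) (L (int i - 1) x)) = (\<Sum>k=1..Suc K. B k x)"
      unfolding B_def by (intro sum.reindex_bij_witness[of _ "\<lambda>k. k + 1" "\<lambda>k. k - 1"]) auto
    also have "X 1 (L (-1) x) = L (-1) (X 1 x) + smul h (X 0 x)"
      using X_L_opposite[of 1 x] by simp
    also have "X 0 (L 0 x) = smul \<kappa> (X 0 x)"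
      using x by (simp add: weight_space_def X.scale)
    finally have 2: "Sum_any (\<lambda>i::nat. X (1 - int i) (L (int i - 1) x)) =
      L (-1) (X 1 x) + smul h (X 0 x) + smul \<kappa> (X 0 x) + (\<Sum>k=1..Suc K. B k x)" .
    have "smul t (S - a + (a + smul h y + smul \<kappa> y + S')) = smul t (S + S') + smul (t * (h + \<kappa>)) y"
      for S S' a y
      by (simp add: scale_right_distrib scale_left_distrib scale_right_diff_distrib distrib_left)
    then show ?thesis
      unfolding null 1 2 .
  qed
  have "h * (h + 1) * T \<kappa> = local.trace_on (E \<kappa>) (\<lambda>x. smul (h * (h + 1)) (X 0 x))"
    unfolding T_def using E_fin X0_E by (subst trace_on_scale) auto
  also have "\<dots> = local.trace_on (E \<kappa>)
      (\<lambda>x. smul t ((\<Sum>k=1..Suc K. A k x) + (\<Sum>k=1..Suc K. B k x)) + smul (t * (h + \<kappa>)) (X 0 x))"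
    by (rule trace_on_cong[OF E_fin reduced])
  also have "\<dots> = t * ((\<Sum>k=1..Suc K. local.trace_on (E \<kappa>) (A k)) + (\<Sum>k=1..Suc K. local.trace_on (E \<kappa>) (B k)))
      + t * (h + \<kappa>) * T \<kappa>"
  proof -
    have S: "(\<lambda>x. \<Sum>k=1..Suc K. A k x) ` E \<kappa> \<subseteq> E \<kappa>" "(\<lambda>x. \<Sum>k=1..Suc K. B k x) ` E \<kappa> \<subseteq> E \<kappa>"
      using A_E B_E by (auto simp: image_subset_iff intro!: subspace_sum[OF sub] simp del: sum.cl_ivl_Suc)
    then have S2: "(\<lambda>x. (\<Sum>k=1..Suc K. A k x) + (\<Sum>k=1..Suc K. B k x)) ` E \<kappa> \<subseteq> E \<kappa>"
      by (auto simp: image_subset_iff intro!: subspace_add[OF sub] simp del: sum.cl_ivl_Suc)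
    then have S3: "(\<lambda>x. smul t ((\<Sum>k=1..Suc K. A k x) + (\<Sum>k=1..Suc K. B k x))) ` E \<kappa> \<subseteq> E \<kappa>"
      using scale_E by (auto simp: image_subset_iff simp del: sum.cl_ivl_Suc)
    have S4: "(\<lambda>x. smul (t * (h + \<kappa>)) (X 0 x)) ` E \<kappa> \<subseteq> E \<kappa>" "X 0 ` E \<kappa> \<subseteq> E \<kappa>"
      using scale_E X0_E by auto
    show ?thesis
      unfolding trace_on_add[OF E_fin S3 S4(1)] trace_on_scale[OF E_fin S2] trace_on_scale[OF E_fin S4(2)]
        trace_on_add[OF E_fin S] T_def
      using A_E B_E by (simp only: trace_on_sum[OF E_fin] finite_atLeastAtMost)
  qed
  also have "(\<Sum>k=1..Suc K. local.trace_on (E \<kappa>) (A k)) =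
      h * (\<Sum>k=1..Suc K. \<Sum>j=1..K. of_nat k * T (\<kappa> - of_nat (j * k)))"
    unfolding A_def sum_distrib_left[of h]
    by (intro sum.cong refl trace_LX[unfolded sum_distrib_left[of h]] K) auto
  also have "(\<Sum>k=1..Suc K. local.trace_on (E \<kappa>) (B k)) =
      h * (\<Sum>k=1..Suc K. \<Sum>j=1..K. of_nat k * T (\<kappa> - of_nat (j * k)))"
    unfolding B_def sum_distrib_left[of h]
    by (intro sum.cong refl trace_XL[unfolded sum_distrib_left[of h]] K) auto
  also have "(\<Sum>k=1..Suc K. \<Sum>j=1..K. of_nat k * T (\<kappa> - of_nat (j * k))) =
      (\<Sum>n=1..K. of_nat (divisor_sum n) * T (\<kappa> - of_nat n))"
    by (rule sum_multiples_eq_divisor_sum) (auto simp: T_def K trace_on_zero_space)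
  finally have "h * (h + 1) * T \<kappa> - t * (h + \<kappa>) * T \<kappa> =
      t * (h * (\<Sum>n=1..K. of_nat (divisor_sum n) * T (\<kappa> - of_nat n)) +
        h * (\<Sum>n=1..K. of_nat (divisor_sum n) * T (\<kappa> - of_nat n)))"
    by (simp only: add_diff_cancel_right')
  moreover have "(h * (h + 1) - t * (h + \<kappa>)) * y = 2 * h * t * S"
    if "h * (h + 1) * y - t * (h + \<kappa>) * y = t * (h * S + h * S)" for y S
    using that by (simp add: algebra_simps)
  ultimately show ?thesis by blast
qed

end

section \<open>The null vector\<close>

context virasoro_module
begin

text \<open>Words in lowering operators, in any order, applied to \<open>v\<close>; for a singular
  \<open>v\<close> their span is the submodule that it generates.\<close>

inductive descendant :: "'a \<Rightarrow> 'a \<Rightarrow> bool" for v where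
  self: "descendant v v"
| lower: "descendant v x \<Longrightarrow> n > 0 \<Longrightarrow> descendant v (L (- n) x)"

lemma L_span:
  assumes "\<And>x. x \<in> A \<Longrightarrow> L n x \<in> span B" "x \<in> span A"
  shows "L n x \<in> span B"
proof -
  interpret L: Vector_Spaces.linear smul smul "L n" by (rule L_linear)
  show ?thesis
    using assms(2)
  proof (induction rule: span_induct_alt)
    case base
    then show ?case by (simp add: L.zero span_zero)
  next
    case (step c x y)
    then show ?case using assms(1) by (simp add: L.add L.scale span_add span_scale)
  qed
qed

text \<open>Moving \<open>L n\<close> past the first letter of a word leaves operators acting on the
  shorter word, which the induction covers for all modes at once.\<close>

lemma submodule_descendants:
  assumes "L 0 v = smul \<mu> v" "\<And>n. n > 0 \<Longrightarrow> L n v = 0"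
  shows "submodule (span {x. descendant v x})"
proof -
  let ?S = "span {x. descendant v x}"
  have low: "L (- m) x \<in> ?S" if "x \<in> ?S" "m > 0" for m x
    by (rule L_span[OF _ that(1)]) (use that(2) in \<open>auto intro: span_base lower\<close>)
  have gen: "\<forall>n. L n x \<in> ?S" if "descendant v x" for x
    using that
  proof induction
    case self
    have v: "v \<in> ?S" by (auto intro: span_base descendant.self)
    show ?case
    proof
      fix n :: int
      consider "n < 0" | "n = 0" | "n > 0" by linarith
      then show "L n v \<in> ?S"
        using low[OF v, of "-n"] v assms by cases (auto simp: span_scale span_zero)
    qed
  next
    case (lower x m)
    have x: "x \<in> ?S" using lower.hyps by (auto intro: span_base)
    show ?case
    proof
      fix n :: int
      have "L n (L (- m) x) = L (- m) (L n x) + (smul (of_int (n + m)) (L (n - m) x) +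
          (if n - m = 0 then smul (of_int (n ^ 3 - n) / 12 * c) x else 0))"
        using L_commutator[of n "- m" x] by (simp add: algebra_simps)
      moreover have "L (- m) (L n x) \<in> ?S" using lower low by blast
      moreover have "L (n - m) x \<in> ?S" using lower by blast
      ultimately show "L n (L (- m) x) \<in> ?S"
        using x by (auto intro!: span_add span_scale span_zero)
    qed
  qed
  show ?thesis
    unfolding submodule_def
  proof (intro conjI allI ballI subspace_span)
    fix n x assume "x \<in> ?S"
    then show "L n x \<in> ?S"
      by (rule L_span[rotated]) (use gen in simp)
  qed
qed

section \<open>Weights in the submodule generated by a singular vector\<close>

lemma L_weight:
  assumes "L 0 x = smul \<nu> x"
  shows "L 0 (L n x) = smul (\<nu> - of_int n) (L n x)"
proof -
  interpret L: Vector_Spaces.linear smul smul "L n" by (rule L_linear)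
  have "L 0 (L n x) = smul (- of_int n) (L n x) + L n (L 0 x)"
    using L_commutator[of 0 n x] by (auto simp: diff_eq_eq)
  then show ?thesis by (simp only: assms L.scale scale_left_distrib[symmetric]) simp
qed

lemma weight_descendant:
  assumes "L 0 v = smul \<mu> v" "descendant v x"
  shows "\<exists>j::nat. L 0 x = smul (\<mu> + of_nat j) x"
  using assms(2)
proof induction
  case self
  then show ?case using assms(1) by (intro exI[of _ 0]) simp
next
  case (lower x n)
  then obtain j where j: "L 0 x = smul (\<mu> + of_nat j) x" by blast
  then have "L 0 (L (- n) x) = smul (\<mu> + of_nat (j + nat n)) (L (- n) x)"
    using L_weight[OF j, of "- n"] lower.hyps by (simp add: add.assoc)
  then show ?case by blast
qed

text \<open>The product of \<open>L 0\<close> - (\<mu> + i) over i < k: a polynomial in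
  \<open>L 0\<close> that annihilates eigenvectors of the weights \<mu>, ..., \<mu> + k - 1.\<close>

primrec kill_weights :: "complex \<Rightarrow> nat \<Rightarrow> 'a \<Rightarrow> 'a" where
  "kill_weights \<mu> 0 x = x"
| "kill_weights \<mu> (Suc k) x = L 0 (kill_weights \<mu> k x) - smul (\<mu> + of_nat k) (kill_weights \<mu> k x)"

lemma kill_weights_add:
  "kill_weights \<mu> k (x + y) = kill_weights \<mu> k x + kill_weights \<mu> k y"
proof -
  interpret L: Vector_Spaces.linear smul smul "L 0" by (rule L_linear)
  show ?thesis by (induction k) (simp_all add: L.add scale_right_distrib)
qed

lemma kill_weights_eigenvector:
  assumes "L 0 x = smul \<nu> x"
  shows "kill_weights \<mu> k (smul a x) = smul (a * (\<Prod>i<k. \<nu> - \<mu> - of_nat i)) x"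
proof -
  interpret L: Vector_Spaces.linear smul smul "L 0" by (rule L_linear)
  show ?thesis
    by (induction k) (simp_all add: L.scale assms flip: scale_left_diff_distrib, simp add: algebra_simps)
qed

lemma kill_weights_mono:
  assumes "kill_weights \<mu> k x = 0" "k \<le> l"
  shows "kill_weights \<mu> l x = 0"
proof -
  interpret L: Vector_Spaces.linear smul smul "L 0" by (rule L_linear)
  show ?thesis
    using assms(2) by (induction rule: dec_induct) (simp_all add: assms(1) L.zero)
qed

text \<open>A finite combination of vectors from \<open>A\<close> involves finitely many weights, so
  some \<open>kill_weights\<close> annihilates x. On an eigenvector of weight \<nu> it acts as a
  nonzero scalar.\<close>

lemma eq_zero_of_span_weights:
  assumes "x \<in> span A" "\<And>y. y \<in> A \<Longrightarrow> \<exists>j::nat. L 0 y = smul (\<mu> + of_nat j) y"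
    and "L 0 x = smul \<nu> x" "\<And>j::nat. \<nu> \<noteq> \<mu> + of_nat j"
  shows "x = 0"
proof -
  have "\<exists>k. kill_weights \<mu> k x = 0"
    using assms(1)
  proof (induction rule: span_induct_alt)
    case base
    show ?case by (intro exI[of _ 0]) simp
  next
    case (step a y z)
    obtain j where j: "L 0 y = smul (\<mu> + of_nat j) y" using assms(2) step by blast
    obtain k where k: "kill_weights \<mu> k z = 0" using step by blast
    have "kill_weights \<mu> (Suc j) (smul a y) = 0"
      unfolding kill_weights_eigenvector[OF j] by simp
    then have "kill_weights \<mu> (max (Suc j) k) (smul a y) = 0"
      by (rule kill_weights_mono) simp
    moreover have "kill_weights \<mu> (max (Suc j) k) z = 0"
      by (rule kill_weights_mono[OF k]) simp
    ultimately have "kill_weights \<mu> (max (Suc j) k) (smul a y + z) = 0"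
      by (simp only: kill_weights_add add_0)
    then show ?case by blast
  qed
  then obtain k where "kill_weights \<mu> k (smul 1 x) = 0" by auto
  then show ?thesis
    unfolding kill_weights_eigenvector[OF assms(3)] using assms(4) by (auto simp: algebra_simps)
qed

text \<open>The submodule generated by v has weights only in \<mu> + {0, 1, ...} and so misses u;
  irreducibility makes it zero.\<close>

lemma singular_vector_eq_zero:
  assumes irr: "\<And>S. submodule S \<Longrightarrow> S = {0} \<or> S = UNIV"
    and v: "L 0 v = smul \<mu> v" "\<And>n. n > 0 \<Longrightarrow> L n v = 0"
    and u: "u \<noteq> 0" "L 0 u = smul \<nu> u" "\<And>j::nat. \<nu> \<noteq> \<mu> + of_nat j"
  shows "v = 0"
proof -
  let ?S = "span {x. descendant v x}"
  have "u \<notin> ?S"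
    using eq_zero_of_span_weights[of u "{x. descendant v x}" \<mu> \<nu>] weight_descendant[OF v(1)] u by auto
  then have "?S = {0}" using irr[OF submodule_descendants[OF v]] by blast
  moreover have "v \<in> ?S" by (auto intro: span_base descendant.self)
  ultimately show ?thesis by simp
qed

section \<open>The singular vector at level two\<close>

lemma L_positive_eq_zero:
  assumes "L 1 v = 0" "L 2 v = 0" "n > 0"
  shows "L n v = 0"
proof (cases "n = 1")
  case False
  then have "n \<ge> 2" using assms(3) by simp
  then show ?thesis
  proof (induction rule: int_ge_induct)
    case base
    then show ?case by (rule assms(2))
  next
    case (step i)
    have z: "L k 0 = 0" for k using L_linear[of k] by (rule module_hom.zero[OF Vector_Spaces.linear.axioms(3)])
    \<comment> \<open>The commutator of \<open>L i\<close> and \<open>L 1\<close> is (i - 1)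
      \<open>L (i + 1)\<close>, and i >= 2 allows division by i - 1.\<close>
    have "smul (of_int (i - 1)) (L (i + 1) v) = 0"
      using L_commutator[of i 1 v] step assms(1) by (simp add: z)
    then show ?case using step.hyps by (simp add: scale_eq_0_iff)
  qed
qed (use assms in simp)

text \<open>The hypothesis on \<open>c\<close> says that \<open>h\<close> is one of the Kac weights \<open>h\<^bsub>1,2\<^esub>\<close>, \<open>h\<^bsub>2,1\<^esub>\<close>, for which
  the Verma module has a singular vector at level 2.\<close>

lemma level_two_null_vector:
  assumes irr: "\<And>S. submodule S \<Longrightarrow> S = {0} \<or> S = UNIV"
    and u: "highest_weight_vector smul h L u"
    and c: "c * (2 * h + 1) = 2 * h * (5 - 8 * h)"
  shows "L (-1) (L (-1) u) = smul ((4 * h + 2) / 3) (L (-2) u)"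
proof -
  interpret L: Vector_Spaces.linear smul smul "L n" for n by (rule L_linear)
  \<comment> \<open>The value with 4h + 2 = 3t, which makes \<open>L 1\<close> annihilate
    \<open>v\<close>.\<close>
  define t where "t = (4 * h + 2) / 3"
  define v where "v = L (-1) (L (-1) u) - smul t (L (-2) u)"
  have up: "L n u = 0" if "n > 0" for n
    using u that by (auto simp: highest_weight_vector_def)
  have u0: "u \<noteq> 0" "L 0 u = smul h u"
    using u by (auto simp: highest_weight_vector_def)
  have comm: "L m (L n x) = L n (L m x) + (smul (of_int (m - n)) (L (m + n) x) +
         (if m + n = 0 then smul (of_int (m ^ 3 - m) / 12 * c) x else 0))" for m n x
    using L_commutator[of m n x] by (simp add: algebra_simps)
  have L0: "L 0 (L (-1) u) = smul (h + 1) (L (-1) u)" "L 0 (L (-2) u) = smul (h + 2) (L (-2) u)"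
    using L_weight[OF u0(2), of "-1"] L_weight[OF u0(2), of "-2"] by simp_all
  have L0': "L 0 (L (-1) (L (-1) u)) = smul (h + 2) (L (-1) (L (-1) u))"
    using L_weight[OF L0(1), of "-1"] by (simp add: add.assoc)
  have L1: "L 1 (L (-1) u) = smul (2 * h) u" "L 1 (L (-2) u) = smul 3 (L (-1) u)" "L 2 (L (-1) u) = 0"
    "L 2 (L (-2) u) = smul (4 * h + c / 2) u"
    using comm[of 1 "-1" u] comm[of 1 "-2" u] comm[of 2 "-1" u] comm[of 2 "-2" u] u0 up
    by (simp_all add: L.zero L.scale scale_left_distrib)
  have L2: "L 1 (L (-1) (L (-1) u)) = smul (4 * h + 2) (L (-1) u)"
  proof -
    have "L 1 (L (-1) (L (-1) u)) = L (-1) (L 1 (L (-1) u)) + smul 2 (L 0 (L (-1) u))"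
      using comm[of 1 "-1" "L (-1) u"] by simp
    also have "\<dots> = smul (2 * h + 2 * (h + 1)) (L (-1) u)"
      by (simp only: L1 L0 L.scale scale_scale scale_left_distrib[symmetric])
    also have "2 * h + 2 * (h + 1) = 4 * h + 2" by simp
    finally show ?thesis .
  qed
  have L2': "L 2 (L (-1) (L (-1) u)) = smul (6 * h) u"
    using comm[of 2 "-1" "L (-1) u"] by (simp add: L1 L.zero)
  have v: "L 0 v = smul (h + 2) v"
    unfolding v_def L.diff L.scale L0 L0' scale_right_diff_distrib scale_left_commute[of t] ..
  have "L 1 v = 0"
    unfolding v_def L.diff L.scale L1 L2 scale_scale by (simp add: t_def)
  \<comment> \<open>The condition is 6h = t (4h + c/2); here the hypothesis on c enters.\<close>
  moreover have "L 2 v = 0"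
  proof -
    have "t * (4 * h + c / 2) = ((4 * h + 2) * (4 * h) + c * (2 * h + 1)) / 3"
      by (simp add: t_def field_simps)
    also have "\<dots> = 6 * h"
      unfolding c by (simp add: field_simps)
    finally show ?thesis
      unfolding v_def L.diff L.scale L1 L2' scale_scale by simp
  qed
  ultimately have v_pos: "L n v = 0" if "n > 0" for n
    using that by (rule L_positive_eq_zero)
  \<comment> \<open>The descendants of \<open>v\<close> have weights h + 2 + j, so \<open>u\<close>
    is not in their span.\<close>
  have "h \<noteq> h + 2 + of_nat j" for j :: nat
  proof
    assume "h = h + 2 + of_nat j"
    then have "of_nat (j + 2) = (0::complex)" by (simp add: algebra_simps)
    then show False unfolding of_nat_eq_0_iff by simp
  qed
  then have "v = 0"
    using singular_vector_eq_zero[OF _ v v_pos u0] irr by blast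
  then show ?thesis by (simp add: v_def t_def)
qed

end

section \<open>Modes of intertwining operators\<close>

context vector_space
begin

text \<open>The k-th difference of f over the points a, ..., a + k, with the sign pattern of (z -
  x)^k. The iterate formula for n >= 0 and locality are both statements about such differences of
  commutators.\<close>

definition backward_difference :: "nat \<Rightarrow> int \<Rightarrow> (int \<Rightarrow> 'b) \<Rightarrow> 'b" where
  "backward_difference k a f = (\<Sum>i\<le>k. scale ((-1) ^ i * of_nat (k choose i)) (f (a + int k - int i)))"

lemma backward_difference_diff:
  "local.backward_difference k a (\<lambda>b. f b - g b) = local.backward_difference k a f - local.backward_difference k a g"
  by (simp add: local.backward_difference_def scale_right_diff_distrib sum_subtractf)

text \<open>The differences at 0 form a triangular system with unit diagonal, so d vanishes on the
  nonnegative integers. The N-th differences are a recurrence with coefficient (-1)^N at the lowest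
  argument, which carries the vanishing downwards.\<close>

lemma eq_zero_of_backward_differences:
  assumes "\<And>k. local.backward_difference k 0 d = 0" "\<And>a. local.backward_difference N a d = 0"
  shows "d a = 0"
proof -
  have nonneg: "d (int k) = 0" for k
  proof (induction k rule: less_induct)
    case (less k)
    have "0 = (\<Sum>i\<in>insert 0 {1..k}. scale ((-1) ^ i * of_nat (k choose i)) (d (int k - int i)))"
      using assms(1)[of k] unfolding local.backward_difference_def
      by (simp add: atMost_atLeast0 atLeastAtMost_insertL)
    also have "\<dots> = d (int k) + (\<Sum>i=1..k. scale ((-1) ^ i * of_nat (k choose i)) (d (int k - int i)))"
      by (subst sum.insert) auto
    also have "(\<Sum>i=1..k. scale ((-1) ^ i * of_nat (k choose i)) (d (int k - int i))) = 0"
    proof (rule sum.neutral, rule ballI)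
      fix i assume i: "i \<in> {1..k}"
      then have "d (int k - int i) = 0" using less.IH[of "k - i"] by (simp add: of_nat_diff)
      then show "scale ((-1) ^ i * of_nat (k choose i)) (d (int k - int i)) = 0" by simp
    qed
    finally show ?case by simp
  qed
  have neg: "d (- int j + 1) = 0 \<and> (\<forall>b > - int j. d b = 0)" for j
  proof (induction j)
    case 0
    show ?case using nonneg by (metis add_0 nonneg_int_cases of_nat_0 of_nat_0_le_iff order_less_imp_le minus_zero zero_le_one)
  next
    case (Suc j)
    have "0 = (\<Sum>i\<in>insert N {..<N}. scale ((-1) ^ i * of_nat (N choose i)) (d (- int j + int N - int i)))"
      using assms(2)[of "- int j"] unfolding local.backward_difference_def by (simp add: lessThan_Suc_atMost[symmetric] lessThan_Suc)
    also have "\<dots> = scale ((-1) ^ N) (d (- int j)) +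
        (\<Sum>i<N. scale ((-1) ^ i * of_nat (N choose i)) (d (- int j + int N - int i)))"
      by (subst sum.insert) auto
    also have "(\<Sum>i<N. scale ((-1) ^ i * of_nat (N choose i)) (d (- int j + int N - int i))) = 0"
      using Suc by (intro sum.neutral) auto
    finally have "d (- int j) = 0" by simp
    moreover have "b = - int j \<or> b > - int j" if "b > - int (Suc j)" for b using that by auto
    ultimately show ?case using Suc by (auto simp: algebra_simps)
  qed
  show ?thesis using neg[of "nat (1 - a)"] by simp
qed

lemma backward_difference_0: "local.backward_difference 0 a f = f a"
  by (simp add: local.backward_difference_def)

lemma backward_difference_1: "local.backward_difference 1 a f = f (a + 1) - f a"
  by (simp add: local.backward_difference_def)

lemma backward_difference_affine:
  assumes "k \<ge> 2"
  shows "local.backward_difference k a (\<lambda>b. scale (of_int b * p + q) y) = 0"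
proof -
  have "(\<Sum>i\<le>k. (-1) ^ i * of_nat (k choose i) * (of_int (a + int k - int i) * p + q)) =
     (of_int (a + int k) * p + q) * (\<Sum>i\<le>k. (-1) ^ i * of_nat (k choose i))
     - p * (\<Sum>i\<le>k. (-1) ^ i * of_nat i * of_nat (k choose i))"
    unfolding sum_distrib_left sum_subtractf[symmetric]
    by (intro sum.cong refl) (simp add: algebra_simps)
  also have "\<dots> = 0"
    using assms choose_alternating_sum[of k, where 'a = 'a] choose_alternating_linear_sum[of k, where 'a = 'a]
    by simp
  finally show ?thesis
    unfolding local.backward_difference_def scale_scale scale_sum_left[symmetric] by simp
qed

end

lemma Sum_any_uminus:
  fixes g :: "'a \<Rightarrow> 'b::ab_group_add"
  shows "Sum_any (\<lambda>i. - g i) = - Sum_any g"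
  by (simp add: Sum_any.expand_set sum_negf)

section \<open>Commutators and iterates of Virasoro modes with an intertwining operator\<close>

context intertwining_operator
begin

text \<open>For n = k >= 0 both expansions of (x - z)^n are the same finite binomial sum, so the
  residue is a k-th difference of commutators. In these the two mode indices always add up to
  s.\<close>

lemma iterate_nonneg:
  "I (YU v (int k) w) (s - of_nat k) x =
   W.M.backward_difference k 0 (\<lambda>a. YW v a (I w (s - of_int a) x) - I w (s - of_int a) (YW v a x))"
proof -
  have gb: "(of_int (int k) gchoose i :: complex) = of_nat (k choose i)" for i
    by (simp add: binomial_gbinomial)
  have 1: "Sum_any (\<lambda>i::nat. smulW ((of_int (int k) gchoose i) * (-1) ^ i)
          (YW v (int k - int i) (I w (s - of_nat k + of_nat i) x))) =
      (\<Sum>i\<le>k. smulW ((-1) ^ i * of_nat (k choose i))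
          (YW v (int k - int i) (I w (s - of_int (int k - int i)) x)))"
  proof (subst Sum_any.expand_superset[of "{..k}"])
    show "{i. smulW ((of_int (int k) gchoose i) * (-1) ^ i)
          (YW v (int k - int i) (I w (s - of_nat k + of_nat i) x)) \<noteq> 0} \<subseteq> {..k}" (is "?S \<subseteq> _")
    proof
      fix i assume "i \<in> ?S"
      then have "k choose i \<noteq> 0" unfolding gb by auto
      then show "i \<in> {..k}" using binomial_eq_0[of k i] by (cases "i \<le> k") auto
    qed
    show "(\<Sum>i\<le>k. smulW ((of_int (int k) gchoose i) * (-1) ^ i)
          (YW v (int k - int i) (I w (s - of_nat k + of_nat i) x))) =
      (\<Sum>i\<le>k. smulW ((-1) ^ i * of_nat (k choose i))
          (YW v (int k - int i) (I w (s - of_int (int k - int i)) x)))"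
      unfolding gb by (intro sum.cong refl) (simp add: mult.commute diff_diff_eq2 diff_add_eq)
  qed auto
  have 2: "Sum_any (\<lambda>i::nat. smulW ((of_int (int k) gchoose i) * (-1) powi (int k - int i))
          (I w (s - of_nat k + of_int (int k) - of_nat i) (YW v (int i) x))) =
      (\<Sum>i\<le>k. smulW ((-1) ^ i * of_nat (k choose i))
          (I w (s - of_int (int k - int i)) (YW v (int k - int i) x)))"
  proof (subst Sum_any.expand_superset[of "{..k}"])
    show "{i. smulW ((of_int (int k) gchoose i) * (-1) powi (int k - int i))
          (I w (s - of_nat k + of_int (int k) - of_nat i) (YW v (int i) x)) \<noteq> 0} \<subseteq> {..k}" (is "?S \<subseteq> _")
    proof
      fix i assume "i \<in> ?S"
      then have "k choose i \<noteq> 0" unfolding gb by auto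
      then show "i \<in> {..k}" using binomial_eq_0[of k i] by (cases "i \<le> k") auto
    qed
    show "(\<Sum>i\<le>k. smulW ((of_int (int k) gchoose i) * (-1) powi (int k - int i))
          (I w (s - of_nat k + of_int (int k) - of_nat i) (YW v (int i) x))) =
      (\<Sum>i\<le>k. smulW ((-1) ^ i * of_nat (k choose i))
          (I w (s - of_int (int k - int i)) (YW v (int k - int i) x)))"
    \<comment> \<open>Reversing i aligns this expansion, in powers of x, with the first one, in
      powers of z, and makes the signs agree.\<close>
    proof (rule sum.reindex_bij_witness[of _ "\<lambda>i. k - i" "\<lambda>i. k - i"])
      fix i assume "i \<in> {..k}"
      then have i: "i \<le> k" "int k - int i = int (k - i)" by auto
      show "smulW ((-1) ^ (k - i) * of_nat (k choose (k - i)))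
          (I w (s - of_int (int k - int (k - i))) (YW v (int k - int (k - i)) x)) =
        smulW ((of_int (int k) gchoose i) * (-1) powi (int k - int i))
          (I w (s - of_nat k + of_int (int k) - of_nat i) (YW v (int i) x))"
        unfolding i(2) power_int_of_nat gb binomial_symmetric[OF i(1), symmetric]
        using i(1) by (simp add: of_nat_diff mult.commute)
    qed auto
  qed auto
  show ?thesis
    unfolding I_iterate 1 2 W.M.backward_difference_def sum_subtractf[symmetric] W.M.scale_right_diff_distrib
    by simp
qed

text \<open>Locality of order N is the vanishing of N-th differences of commutators.
  \<open>N0\<close> is the same at every position m, as the passage to negative modes
  requires.\<close>

lemma locality_difference:
  obtains N0 where "\<And>N m. N \<ge> N0 \<Longrightarrow>
   W.M.backward_difference N m (\<lambda>a. YW v a (I w (s - of_int a) x) - I w (s - of_int a) (YW v a x)) = 0"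
proof -
  obtain N0 where N0: "\<forall>N\<ge>N0. \<forall>m r x.
      (\<Sum>i\<le>N. smulW ((-1) ^ i * of_nat (N choose i))
         (YW v (m + int N - int i) (I w (r + of_nat i) x)
          - I w (r + of_nat i) (YW v (m + int N - int i) x))) = 0"
    using I_locality[of v w] ..
  have "W.M.backward_difference N m (\<lambda>a. YW v a (I w (s - of_int a) x) - I w (s - of_int a) (YW v a x)) = 0"
    if "N \<ge> N0" for N m
  proof -
    have *: "s - of_int (m + int N - int i) = s - of_int (m + int N) + of_nat i" for i
      by simp
    show ?thesis
      unfolding W.M.backward_difference_def * by (rule N0[rule_format, OF that])
  qed
  then show ?thesis using that by blast
qed

text \<open>The iterate formula gives the commutator with \<open>\<omega>(a)\<close> for \<open>a \<ge> 0\<close> only. Locality makes it a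
  polynomial in \<open>a\<close>, so that the formula extends to all \<open>a\<close>.\<close>

lemma commutator_highest_weight:
  assumes u: "highest_weight_vector smulU h (virasoro_mode YU \<omega>) u"
  shows "YW \<omega> a (I u (s - of_int a) x) - I u (s - of_int a) (YW \<omega> a x) =
    smulW (of_int a * h - s) (I u (s - 1) x)"
proof -
  let ?f = "\<lambda>a. YW \<omega> a (I u (s - of_int a) x) - I u (s - of_int a) (YW \<omega> a x)"
  let ?g = "\<lambda>a. smulW (of_int a * h + (- s)) (I u (s - 1) x)"
  let ?D = "W.M.backward_difference"
  interpret Il: Vector_Spaces.linear smulU smulW "\<lambda>w. I w r y" for r y
    by (rule I_linear_left)
  \<comment> \<open>As \<omega>(k) = L(k - 1), only the differences at 0 of orders 0 and 1 survive;
    they come from L(-1) and L(0).\<close>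
  have up: "YU \<omega> (int k) u = 0" if "k \<ge> 2" for k
    using u that unfolding highest_weight_vector_def virasoro_mode_def
    by (auto dest: spec[of _ "int k - 1"])
  have u1: "YU \<omega> (int 1) u = smulU h u"
    using u unfolding highest_weight_vector_def virasoro_mode_def by simp
  have u0: "I (YU \<omega> (int 0) u) (s - of_nat 0) x = smulW (- s) (I u (s - 1) x)"
    using I_derivative[of u s x] by (simp add: virasoro_mode_def)
  have d0: "?D 0 0 ?f = smulW (- s) (I u (s - 1) x)"
    unfolding iterate_nonneg[of \<omega> 0 u s x, symmetric] by (rule u0)
  have d1: "?D 1 0 ?f = smulW h (I u (s - 1) x)"
    unfolding iterate_nonneg[of \<omega> 1 u s x, symmetric] u1 Il.scale by simp
  have d2: "?D k 0 ?f = 0" if "k \<ge> 2" for k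
    using iterate_nonneg[of \<omega> k u s x, symmetric] unfolding up[OF that] Il.zero .
  have g0: "?D 0 0 ?g = smulW (- s) (I u (s - 1) x)" "?D 1 0 ?g = smulW h (I u (s - 1) x)"
    unfolding W.M.backward_difference_0 W.M.backward_difference_1
    by (simp_all add: W.M.scale_left_diff_distrib)
  have "?D k 0 (\<lambda>a. ?f a - ?g a) = 0" for k
  proof -
    consider "k = 0" | "k = 1" | "k \<ge> 2" by linarith
    then have "?D k 0 ?f = ?D k 0 ?g"
    proof cases
      case 1
      show ?thesis unfolding 1 d0 g0 ..
    next
      case 2
      show ?thesis unfolding 2 d1 g0 ..
    next
      case 3
      show ?thesis unfolding d2[OF 3] W.M.backward_difference_affine[OF 3] ..
    qed
    then show ?thesis unfolding W.M.backward_difference_diff by simp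
  qed
  moreover obtain N0 where N0: "\<And>N m. N \<ge> N0 \<Longrightarrow> ?D N m ?f = 0"
    using locality_difference[of \<omega> u s x] by blast
  \<comment> \<open>Locality annihilates \<open>?f\<close> from order \<open>N0\<close> on, and the
    affine \<open>?g\<close> vanishes from order 2 on; \<open>N0 + 2\<close> serves both.\<close>
  have "?D (N0 + 2) m (\<lambda>a. ?f a - ?g a) = 0" for m
  proof -
    have "?D (N0 + 2) m ?f = 0" by (rule N0) simp
    moreover have "?D (N0 + 2) m ?g = 0" by (rule W.M.backward_difference_affine) simp
    ultimately show ?thesis unfolding W.M.backward_difference_diff by simp
  qed
  ultimately have "?f a - ?g a = 0"
    by (rule W.M.eq_zero_of_backward_differences)
  then show ?thesis by simp
qed

text \<open>For n = -1 the binomial coefficients are (-1)^i and all signs cancel. The result is the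
  normally ordered product of Y(v,z) and I(w,z).\<close>

lemma iterate_minus_one:
  "I (YU v (-1) w) r x = Sum_any (\<lambda>i::nat. YW v (-1 - int i) (I w (r + of_nat i) x)) +
     Sum_any (\<lambda>i::nat. I w (r - 1 - of_nat i) (YW v (int i) x))"
proof -
  have g: "(of_int (-1) gchoose i :: complex) = (-1) ^ i" for i
    using gbinomial_minus[of "1::complex" i] by (simp add: binomial_gbinomial[symmetric])
  have 1: "(of_int (-1) gchoose i) * (-1) ^ i = (1::complex)" for i
    unfolding g by (simp flip: power_mult_distrib)
  have 2: "(of_int (-1) gchoose i) * (-1) powi (-1 - int i) = (-1::complex)" for i
  proof -
    have "(-1::complex) powi (-1 - int i) = (-1) powi (- int (Suc i))" by (simp add: algebra_simps)
    also have "\<dots> = inverse ((-1) ^ Suc i)" by (simp only: power_int_minus power_int_of_nat)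
    also have "\<dots> = - ((-1) ^ i)" by (cases "even i") auto
    finally show ?thesis unfolding g by (simp flip: power_mult_distrib)
  qed
  show ?thesis
    unfolding I_iterate 1 2 by (simp add: Sum_any_uminus)
qed

lemma primary_field_modes:
  assumes "virasoro_module smulW c (virasoro_mode YW \<omega>)"
    and u: "highest_weight_vector smulU h (virasoro_mode YU \<omega>) u"
  shows "primary_field smulW c (virasoro_mode YW \<omega>) h (\<lambda>n. I u (h - 1 + of_int n))"
proof -
  interpret virasoro_module smulW c "virasoro_mode YW \<omega>" by fact
  show ?thesis
  proof (intro primary_field.intro primary_field_axioms.intro)
    show "virasoro_module smulW c (virasoro_mode YW \<omega>)" by fact
    show "Vector_Spaces.linear smulW smulW (I u (h - 1 + of_int n))" for n :: int
      by (rule I_linear_right)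
    show "virasoro_mode YW \<omega> m (I u (h - 1 + of_int n) x) =
        I u (h - 1 + of_int n) (virasoro_mode YW \<omega> m x) +
        smulW (of_int m * (h - 1) - of_int n) (I u (h - 1 + of_int (m + n)) x)" for m n x
    proof -
      \<comment> \<open>In the commutator formula s is the sum of both indices, here (m + 1) + (h -
        1 + n).\<close>
      have "h + of_int m + of_int n - of_int (m + 1) = h - 1 + of_int n"
        "h + of_int m + of_int n - 1 = h - 1 + of_int (m + n)"
        "of_int (m + 1) * h - (h + of_int m + of_int n) = of_int m * (h - 1) - of_int n"
        by (simp_all add: algebra_simps)
      with commutator_highest_weight[OF u, of "m + 1" "h + of_int m + of_int n" x]
      show ?thesis by (simp add: virasoro_mode_def algebra_simps)
    qed
    show "\<exists>B. finite B \<and> weight_space smulW (virasoro_mode YW \<omega>) \<kappa> \<subseteq> W.M.span B" for \<kappa>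
      by (rule W.YM_finite_dim)
    show "\<exists>N::int. \<forall>k<N. weight_space smulW (virasoro_mode YW \<omega>) (\<kappa> + of_int k) = {0}" for \<kappa>
      by (rule W.YM_bounded_below)
  qed
qed

lemma weight_highest_weight_vector:
  assumes "highest_weight_vector smulU h (virasoro_mode YU \<omega>) u"
  shows "weight smulU (virasoro_mode YU \<omega>) u = h"
  unfolding weight_def
  using assms by (intro the_equality) (auto simp: highest_weight_vector_def)

text \<open>Each L(-1) differentiates, which gives r (r - 1) and the index r - 2; L(-2) is
  \<omega>(-1), to which \<open>iterate_minus_one\<close> applies.\<close>

lemma null_vector_modes:
  assumes "virasoro_mode YU \<omega> (-1) (virasoro_mode YU \<omega> (-1) u) = smulU t (virasoro_mode YU \<omega> (-2) u)"
  shows "smulW (r * (r - 1)) (I u (r - 2) x) =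
    smulW t (Sum_any (\<lambda>i::nat. YW \<omega> (-1 - int i) (I u (r + of_nat i) x)) +
             Sum_any (\<lambda>i::nat. I u (r - 1 - of_nat i) (YW \<omega> (int i) x)))"
proof -
  interpret Il: Vector_Spaces.linear smulU smulW "\<lambda>w. I w s y" for s y
    by (rule I_linear_left)
  have "smulW (r * (r - 1)) (I u (r - 2) x) = I (virasoro_mode YU \<omega> (-1) (virasoro_mode YU \<omega> (-1) u)) r x"
    unfolding I_derivative W.M.scale_scale diff_diff_eq by (simp add: algebra_simps)
  also have "\<dots> = smulW t (I (YU \<omega> (-1) u) r x)"
    unfolding assms Il.scale by (simp add: virasoro_mode_def)
  finally show ?thesis unfolding iterate_minus_one .
qed

lemma trace_coeff_recursion:
  assumes WV: "virasoro_module smulW c (virasoro_mode YW \<omega>)"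
    and UV: "irreducible_highest_weight_module smulU c h (virasoro_mode YU \<omega>)"
    and u: "highest_weight_vector smulU h (virasoro_mode YU \<omega>) u"
    and c: "c * (2 * h + 1) = 2 * h * (5 - 8 * h)" and h: "2 * h + 1 \<noteq> 0"
  shows "\<exists>K. (\<forall>n\<ge>K. trace_coeff u (\<kappa> - of_nat n) = 0) \<and>
    (\<kappa> - (c / 24 + h / 12)) * trace_coeff u \<kappa> =
      - (2 * h) * (\<Sum>n=1..K. of_nat (divisor_sum n) * trace_coeff u (\<kappa> - of_nat n))"
proof -
  interpret UV: irreducible_highest_weight_module smulU c h "virasoro_mode YU \<omega>" by fact
  interpret X: primary_field smulW c "virasoro_mode YW \<omega>" h "\<lambda>n. I u (h - 1 + of_int n)"
    by (rule primary_field_modes[OF WV u])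
  define t where "t = (4 * h + 2) / 3"
  have t: "t \<noteq> 0"
  proof -
    have "t = 2 * (2 * h + 1) / 3" by (simp add: t_def)
    then show ?thesis using h by (simp only: divide_eq_0_iff mult_eq_0_iff) simp
  qed
  have T: "X.T = trace_coeff u"
    by (intro ext) (simp add: X.T_def trace_coeff_def zero_mode_def weight_highest_weight_vector[OF u])
  have "virasoro_mode YU \<omega> (-1) (virasoro_mode YU \<omega> (-1) u) = smulU t (virasoro_mode YU \<omega> (-2) u)"
    unfolding t_def by (rule UV.level_two_null_vector[OF UV.irreducible u c])
  \<comment> \<open>With r = h + 1 the index r - 2 = h - 1 is that of the zero mode of u.\<close>
  note null = null_vector_modes[OF this, of "h + 1"]
  have null': "smulW (h * (h + 1)) (I u (h - 1 + of_int 0) x) =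
      smulW t (Sum_any (\<lambda>i::nat. virasoro_mode YW \<omega> (-2 - int i) (I u (h - 1 + of_int (2 + int i)) x)) +
              Sum_any (\<lambda>i::nat. I u (h - 1 + of_int (1 - int i)) (virasoro_mode YW \<omega> (int i - 1) x)))" for x
  proof -
    have index: "h * (h + 1) = (h + 1) * (h + 1 - 1)" "h - 1 + of_int 0 = h + 1 - 2"
      "h - 1 + of_int (2 + int i) = h + 1 + of_nat i" "h - 1 + of_int (1 - int i) = h + 1 - 1 - of_nat i"
      "-2 - int i + 1 = -1 - int i" "int i - 1 + 1 = int i" for i
      by simp_all
    show ?thesis
      unfolding virasoro_mode_def index by (rule null)
  qed
  obtain K where K: "\<And>n. n \<ge> K \<Longrightarrow> X.E (\<kappa> - of_nat n) = {0}"
    using X.vanishing_below[of \<kappa>] by blast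
  let ?S = "\<Sum>n=1..K. of_nat (divisor_sum n) * trace_coeff u (\<kappa> - of_nat n)"
  have zero: "trace_coeff u (\<kappa> - of_nat n) = 0" if "n \<ge> K" for n
    unfolding T[symmetric] X.T_def K[OF that] by (rule W.M.trace_on_zero_space)
  have rec: "(h * (h + 1) - t * (h + \<kappa>)) * trace_coeff u \<kappa> = 2 * h * t * ?S"
    using X.trace_recursion[OF null' K] unfolding T by blast
  \<comment> \<open>The relation between c and h, used a second time, makes c/24 + h/12 the zero of
    this linear function of \<kappa>.\<close>
  have coeff: "h * (h + 1) - t * (h + \<kappa>) = - t * (\<kappa> - (c / 24 + h / 12))"
  proof -
    have "t * (h + (c / 24 + h / 12)) = (4 * h + 2) / 3 * (13 * h / 12) + c * (2 * h + 1) / 36"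
      unfolding t_def by (simp add: field_simps)
    also have "\<dots> = h * (h + 1)"
      unfolding c by (simp add: field_simps)
    finally show ?thesis by (simp add: algebra_simps)
  qed
  have "- t * ((\<kappa> - (c / 24 + h / 12)) * trace_coeff u \<kappa>) = - t * (- (2 * h) * ?S)"
    using rec unfolding coeff by (simp add: mult_ac)
  then have "(\<kappa> - (c / 24 + h / 12)) * trace_coeff u \<kappa> = - (2 * h) * ?S"
    using t by (simp only: mult_cancel_left neg_equal_0_iff_equal simp_thms)
  with zero show ?thesis by blast
qed

end

section \<open>The eta product\<close>

text \<open>\<open>l\<close> is the only weight at which the support of \<open>T\<close> can start;
  the truncation \<open>K\<close> may depend on \<kappa>.\<close>

locale divisor_sum_recursion =
  fixes T :: "complex \<Rightarrow> complex" and l e :: complex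
  assumes recursion: "\<exists>K. (\<forall>n\<ge>K. T (\<kappa> - of_nat n) = 0) \<and>
      (\<kappa> - l) * T \<kappa> = - e * (\<Sum>n=1..K. of_nat (divisor_sum n) * T (\<kappa> - of_nat n))"
begin

lemma eq_of_minimal:
  assumes "T \<kappa> \<noteq> 0" "\<And>n. n > 0 \<Longrightarrow> T (\<kappa> - of_nat n) = 0"
  shows "\<kappa> = l"
  using recursion[of \<kappa>] assms by auto

text \<open>Going down from \<kappa> in integer steps, the last nonzero value sits at a minimal
  weight, which must be \<open>l\<close>.\<close>

lemma support:
  assumes "T \<kappa> \<noteq> 0"
  obtains n :: nat where "\<kappa> = l + of_nat n"
proof -
  obtain K where K: "\<And>n. n \<ge> K \<Longrightarrow> T (\<kappa> - of_nat n) = 0"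
    using recursion[of \<kappa>] by blast
  define n where "n = (GREATEST n. T (\<kappa> - of_nat n) \<noteq> 0)"
  have bound: "m \<le> K" if "T (\<kappa> - of_nat m) \<noteq> 0" for m
    using K[of m] that by (cases "m \<le> K") auto
  have "T (\<kappa> - of_nat n) \<noteq> 0"
    unfolding n_def by (rule GreatestI_nat[of _ 0 K]) (use assms bound in auto)
  moreover have "T (\<kappa> - of_nat n - of_nat m) = 0" if "m > 0" for m
  proof (rule ccontr)
    assume "T (\<kappa> - of_nat n - of_nat m) \<noteq> 0"
    then have "T (\<kappa> - of_nat (n + m)) \<noteq> 0" by (simp add: diff_diff_eq)
    then have "n + m \<le> n" unfolding n_def by (rule Greatest_le_nat[where b = K]) (rule bound)
    with that show False by simp
  qed
  ultimately have "\<kappa> - of_nat n = l" by (rule eq_of_minimal)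
  then show ?thesis using that[of n] by (simp add: algebra_simps)
qed

lemma coefficient_recursion:
  "of_nat n * T (l + of_nat n) = - e * (\<Sum>k=1..n. of_nat (divisor_sum k) * T (l + of_nat (n - k)))"
proof -
  let ?f = "\<lambda>k. of_nat (divisor_sum k) * T (l + of_nat n - of_nat k)"
  obtain K where K: "\<And>k. k \<ge> K \<Longrightarrow> T (l + of_nat n - of_nat k) = 0"
    "(l + of_nat n - l) * T (l + of_nat n) = - e * (\<Sum>k=1..K. ?f k)"
    using recursion[of "l + of_nat n"] by blast
  have neg: "T (l + of_nat n - of_nat k) = 0" if "k > n" for k
  proof (rule ccontr)
    assume "T (l + of_nat n - of_nat k) \<noteq> 0"
    then obtain m :: nat where "l + of_nat n - of_nat k = l + of_nat m" by (rule support)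
    then have "of_nat n = (of_nat (m + k) :: complex)" by (simp add: algebra_simps)
    then have "n = m + k" by (simp only: of_nat_eq_iff)
    with that show False by simp
  qed
  \<comment> \<open>K and n are not ordered, so both sums are padded with zeros up to
    \<open>max K n\<close>.\<close>
  have "(\<Sum>k=1..K. ?f k) = (\<Sum>k=1..max K n. ?f k)"
    by (rule sum.mono_neutral_left) (auto simp: K(1))
  also have "\<dots> = (\<Sum>k=1..n. ?f k)"
    by (rule sum.mono_neutral_right) (auto simp: neg)
  also have "\<dots> = (\<Sum>k=1..n. of_nat (divisor_sum k) * T (l + of_nat (n - k)))"
    by (rule sum.cong) (auto simp: of_nat_diff add_diff_eq)
  finally show ?thesis using K(2) by simp
qed

text \<open>No weight of the support lies a positive integer below \<kappa>, so \<kappa> is minimal.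
  The normalization thus reads \<open>T l = 1\<close>, the initial value of the recursion.\<close>

lemma leading_weight:
  assumes "T \<kappa> = 1" "\<And>\<mu>. T \<mu> \<noteq> 0 \<Longrightarrow> \<mu> = \<kappa> \<or> Re \<kappa> < Re \<mu>"
  shows "\<kappa> = l"
proof (rule eq_of_minimal)
  show "T (\<kappa> - of_nat n) = 0" if "n > 0" for n
    using assms(2)[of "\<kappa> - of_nat n"] that by (auto simp: complex_eq_iff)
qed (simp add: assms(1))

end

section \<open>The logarithm of the product as a Lambert series\<close>

lemma lambert_summable:
  fixes q :: complex
  assumes "norm q < 1"
  shows "(\<lambda>(i, j). q ^ (Suc i * Suc j) / of_nat (Suc j)) summable_on (UNIV \<times> UNIV)"
proof -
  have q: "norm (norm q) < 1" using assms by simp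
  have geo: "((\<lambda>j. norm q ^ j) has_sum (1 / (1 - norm q))) UNIV"
    using geometric_sums[OF q] summable_geometric[OF q]
    by (intro norm_summable_imp_has_sum) (auto simp: norm_power)
  have "(\<lambda>(i, j). norm q ^ i * norm q ^ j) summable_on (UNIV \<times> UNIV)"
  proof (rule summable_on_SigmaI)
    show "((\<lambda>j. case (i, j) of (i, j) \<Rightarrow> norm q ^ i * norm q ^ j) has_sum (norm q ^ i * (1 / (1 - norm q)))) UNIV" for i
      using has_sum_cmult_right[OF geo, of "norm q ^ i"] by simp
    show "(\<lambda>i. norm q ^ i * (1 / (1 - norm q))) summable_on UNIV"
      using has_sum_cmult_left[OF geo] has_sum_imp_summable by blast
  qed auto
  then have "(\<lambda>x. norm (case x of (i, j) \<Rightarrow> norm q ^ i * norm q ^ j)) summable_on (UNIV \<times> UNIV)"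
    by (simp add: case_prod_unfold abs_mult)
  then have "(\<lambda>x. norm (case x of (i, j) \<Rightarrow> q ^ (Suc i * Suc j) / of_nat (Suc j))) summable_on (UNIV \<times> UNIV)"
  proof (rule Infinite_Sum.abs_summable_on_comparison_test, clarify)
    fix i j :: nat
    have "norm (q ^ (Suc i * Suc j) / of_nat (Suc j)) = norm q ^ (Suc i * Suc j) / real (Suc j)"
      by (simp only: norm_divide norm_power norm_of_nat)
    also have "\<dots> \<le> norm q ^ (Suc i * Suc j) / 1"
      by (intro divide_left_mono) auto
    \<comment> \<open>Since (i + 1)(j + 1) >= i + j, a product of two geometric series
      dominates.\<close>
    also have "\<dots> \<le> norm q ^ (i + j)"
      unfolding div_by_1 by (rule power_decreasing) (use assms in auto)
    also have "\<dots> = norm (norm q ^ i * norm q ^ j)"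
      by (simp add: power_add abs_mult)
    finally show "norm (q ^ (Suc i * Suc j) / of_nat (Suc j)) \<le> norm (norm q ^ i * norm q ^ j)" .
  qed
  then show ?thesis by (rule Infinite_Sum.abs_summable_summable)
qed

text \<open>The pair (i, j) corresponds to n = (i + 1)(j + 1) with the divisor d = i + 1; factors
  start at 1, indices at 0.\<close>

lemma divisor_pairs_bij:
  "bij_betw (\<lambda>(n, d). (d - 1, n div d - 1)) (Sigma {0<..} (\<lambda>n. {d. d dvd n})) (UNIV \<times> UNIV :: (nat \<times> nat) set)"
proof (rule bij_betwI[where g = "\<lambda>(i, j). (Suc i * Suc j, Suc i)"])
  show "(case case x of (n, d) \<Rightarrow> (d - 1, n div d - 1) of (i, j) \<Rightarrow> (Suc i * Suc j, Suc i)) = x"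
    if "x \<in> Sigma {0<..} (\<lambda>n. {d. d dvd n})" for x :: "nat \<times> nat"
  proof -
    obtain n d where nd: "x = (n, d)" by (cases x)
    with that have x: "x = (n, d)" "n > 0" "d dvd n" by auto
    then obtain k where k: "n = d * k" by blast
    then have "d > 0" "k > 0" using x by auto
    then have "Suc (d - 1) = d" "Suc (n div d - 1) = k" using k by simp_all
    then show ?thesis using x k by (simp only: prod.case)
  qed
  show "(case case y of (i, j) \<Rightarrow> (Suc i * Suc j, Suc i) of (n, d) \<Rightarrow> (d - 1, n div d - 1)) = y"
    for y :: "nat \<times> nat"
    by (cases y) (simp del: mult_Suc mult_Suc_right)
qed (auto simp del: mult_Suc mult_Suc_right)

text \<open>Expand each logarithm and sum the double series along n = (i + 1)(j + 1). As 1/(j + 1) =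
  d/n for d = i + 1, the divisors of n contribute their sum over n.\<close>

lemma sums_ln_product:
  fixes q :: complex
  assumes "norm q < 1"
  obtains s where "(\<lambda>i. ln (1 - q ^ Suc i)) sums s"
    "(\<lambda>n. - (of_nat (divisor_sum n) / of_nat n) * q ^ n) sums s"
proof -
  define f where "f = (\<lambda>(i, j). q ^ (Suc i * Suc j) / of_nat (Suc j))"
  define S where "S = infsum f (UNIV \<times> UNIV)"
  have f: "(f has_sum S) (UNIV \<times> UNIV)"
    unfolding S_def f_def by (intro has_sum_infsum lambert_summable assms)
  have row: "((\<lambda>j. f (i, j)) has_sum (- ln (1 - q ^ Suc i))) UNIV" for i
  proof -
    have less: "norm (q ^ Suc i) < 1"
      using power_strict_mono[of "norm q" 1 "Suc i"] assms by (simp add: norm_power del: power_Suc)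
    have "(\<lambda>j. (q ^ Suc i) ^ j / of_nat j) sums (- ln (1 - q ^ Suc i))"
      using sums_minus[OF Ln_series'[of "- (q ^ Suc i)"]] less by simp
    \<comment> \<open>The term j = 0 is 1/0 = 0, so dropping it leaves the sum unchanged.\<close>
    then have "(\<lambda>j. (q ^ Suc i) ^ Suc j / of_nat (Suc j)) sums (- ln (1 - q ^ Suc i))"
      by (subst sums_Suc_iff) simp
    then have "(\<lambda>j. f (i, j)) sums (- ln (1 - q ^ Suc i))"
      unfolding f_def by (simp only: prod.case power_mult)
    moreover have "(\<lambda>j. f (i, j)) summable_on UNIV"
      using has_sum_imp_summable[OF f] by (intro summable_on_SigmaD1[of "\<lambda>x y. f (x, y)" UNIV]) auto
    ultimately show ?thesis
      using has_sum_infsum has_sum_imp_sums sums_unique2 by metis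
  qed
  have "((\<lambda>i. - ln (1 - q ^ Suc i)) has_sum S) UNIV"
    by (rule has_sum_SigmaD[OF f row])
  from sums_minus[OF has_sum_imp_sums[OF this]]
  have 1: "(\<lambda>i. ln (1 - q ^ Suc i)) sums (- S)" by simp
  have "((\<lambda>x. f ((\<lambda>(n, d). (d - 1, n div d - 1)) x)) has_sum S) (Sigma {0<..} (\<lambda>n. {d. d dvd n}))"
    using f has_sum_reindex_bij_betw[OF divisor_pairs_bij] by blast
  then have "((\<lambda>n. of_nat (divisor_sum n) / of_nat n * q ^ n) has_sum S) {0<..}"
  proof (rule has_sum_SigmaD)
    fix n :: nat assume n: "n \<in> {0<..}"
    have fin: "finite {d. d dvd n}" using n by auto
    have "f (d - 1, n div d - 1) = of_nat d / of_nat n * q ^ n" if d: "d dvd n" for d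
    proof -
      obtain k where k: "n = d * k" using d by blast
      then have "d > 0" "k > 0" using n by auto
      then have "Suc (d - 1) = d" "Suc (n div d - 1) = k" using k by simp_all
      then have "f (d - 1, n div d - 1) = q ^ n / of_nat k"
        unfolding f_def by (simp only: prod.case k)
      then show ?thesis using \<open>d > 0\<close> by (simp add: k)
    qed
    then have "(\<Sum>d | d dvd n. f (d - 1, n div d - 1)) = of_nat (divisor_sum n) / of_nat n * q ^ n"
      unfolding divisor_sum_def by (simp add: sum_distrib_right sum_divide_distrib)
    then show "((\<lambda>d. f (case (n, d) of (n, d) \<Rightarrow> (d - 1, n div d - 1))) has_sum
        (of_nat (divisor_sum n) / of_nat n * q ^ n)) {d. d dvd n}"
      using has_sum_finite[OF fin, of "\<lambda>d. f (d - 1, n div d - 1)"] by simp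
  qed
  \<comment> \<open>The added term n = 0 is zero because division by 0 gives 0.\<close>
  also have "?this \<longleftrightarrow> ((\<lambda>n. of_nat (divisor_sum n) / of_nat n * q ^ n) has_sum S) UNIV"
    by (rule has_sum_cong_neutral) auto
  finally have "((\<lambda>n. of_nat (divisor_sum n) / of_nat n * q ^ n) has_sum S) UNIV" .
  from sums_minus[OF has_sum_imp_sums[OF this]]
  have 2: "(\<lambda>n. - (of_nat (divisor_sum n) / of_nat n) * q ^ n) sums (- S)" by simp
  show ?thesis using that 1 2 by blast
qed

text \<open>The recursion is A' = A g' for A = exp g, read coefficientwise, where g is e times the
  sum of the logarithms. Convergence to the product on the whole unit disc comes from the holomorphy
  of exp g there.\<close>

lemma prodinf_powr_has_sum:
  fixes b :: "nat \<Rightarrow> complex" and e q :: complex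
  assumes b0: "b 0 = 1"
    and b: "\<And>n. of_nat n * b n = - e * (\<Sum>k=1..n. of_nat (divisor_sum k) * b (n - k))"
    and q: "norm q < 1"
  shows "((\<lambda>n. b n * q ^ n) has_sum (prodinf (\<lambda>n. (1 - q ^ Suc n) powr e))) UNIV"
proof -
  define g :: "complex fps" where "g = Abs_fps (\<lambda>n. e * - (of_nat (divisor_sum n) / of_nat n))"
  have g_sums: "\<exists>s. (\<lambda>i. ln (1 - z ^ Suc i)) sums s \<and> (\<lambda>n. fps_nth g n * z ^ n) sums (e * s)"
    if z: "norm z < 1" for z
  proof -
    obtain s where s: "(\<lambda>i. ln (1 - z ^ Suc i)) sums s"
      "(\<lambda>n. - (of_nat (divisor_sum n) / of_nat n) * z ^ n) sums s"
      using sums_ln_product[OF z] .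
    have "(\<lambda>n. fps_nth g n * z ^ n) sums (e * s)"
      using sums_mult[OF s(2), of e] unfolding g_def fps_nth_Abs_fps mult.assoc .
    with s(1) show ?thesis by blast
  qed
  have radius: "fps_conv_radius g \<ge> 1"
    unfolding fps_conv_radius_def
  proof (rule conv_radius_geI_ex')
    fix r :: real assume "0 < r" "ereal r < 1"
    then have "norm (of_real r :: complex) < 1" by simp
    from g_sums[OF this] show "summable (\<lambda>n. fps_nth g n * of_real r ^ n)"
      by (auto simp: summable_def)
  qed
  define F where "F = exp \<circ> eval_fps g"
  define A where "A = fps_exp 1 oo g"
  have sub: "eball 0 1 \<subseteq> eball (0 :: complex) (fps_conv_radius g)"
  proof
    fix t :: complex assume "t \<in> eball 0 1"
    then have "ereal (norm t) < 1" by simp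
    from less_le_trans[OF this radius] show "t \<in> eball 0 (fps_conv_radius g)" by simp
  qed
  have hol: "F holomorphic_on eball 0 1"
    unfolding F_def by (intro holomorphic_on_compose holomorphic_on_exp holomorphic_on_eval_fps sub)
  have g0: "fps_nth g 0 = 0" by (simp add: g_def)
  have exp: "F has_fps_expansion A"
    unfolding F_def A_def
    by (intro has_fps_expansion_compose has_fps_expansion_exp1 eval_fps_has_fps_expansion g0)
       (use radius in \<open>auto intro: less_le_trans[of _ 1]\<close>)
  have deriv: "fps_deriv A = A * fps_deriv g"
    unfolding A_def by (simp add: fps_compose_deriv[OF g0])
  have A: "fps_nth A n = b n" for n
  proof (induction n rule: less_induct)
    case (less n)
    show ?case
    proof (cases n)
      case 0
      then show ?thesis by (simp add: A_def b0)
    next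
      case (Suc m)
      have "of_nat n * fps_nth A n = fps_nth (fps_deriv g * A) m"
        using arg_cong[OF deriv, of "\<lambda>f. fps_nth f m"]
        by (simp only: fps_deriv_nth Suc Suc_eq_plus1 mult.commute[of "fps_deriv g"])
      also have "\<dots> = (\<Sum>i=0..m. of_nat (Suc i) * fps_nth g (Suc i) * fps_nth A (m - i))"
        by (simp add: fps_mult_nth)
      also have "\<dots> = (\<Sum>i=0..m. - e * (of_nat (divisor_sum (Suc i)) * b (m - i)))"
      proof (rule sum.cong[OF refl])
        fix i assume "i \<in> {0..m}"
        have "of_nat (Suc i) * fps_nth g (Suc i) = - e * of_nat (divisor_sum (Suc i))"
          unfolding g_def fps_nth_Abs_fps by (simp del: of_nat_Suc)
        moreover have "fps_nth A (m - i) = b (m - i)" by (rule less.IH) (simp add: Suc)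
        ultimately show "of_nat (Suc i) * fps_nth g (Suc i) * fps_nth A (m - i) =
            - e * (of_nat (divisor_sum (Suc i)) * b (m - i))"
          by (simp only: mult.assoc)
      qed
      also have "\<dots> = - e * (\<Sum>k=1..n. of_nat (divisor_sum k) * b (n - k))"
        unfolding sum_distrib_left Suc
        by (rule sum.reindex_bij_witness[of _ "\<lambda>k. k - 1" Suc]) auto
      also have "\<dots> = of_nat n * b n" by (rule b[symmetric])
      finally show ?thesis using Suc by (simp del: of_nat_Suc)
    qed
  qed
  have "(\<lambda>n. b n * q ^ n) sums F q"
    using has_fps_expansion_imp_sums_complex[OF exp hol, of q] q by (simp add: A)
  moreover have "summable (\<lambda>n. norm (b n * q ^ n))"
  proof -
    have "norm q < fps_conv_radius A"
      using holomorphic_on_imp_fps_conv_radius_ge[OF exp hol] q by (auto intro: less_le_trans[of _ 1])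
    from norm_summable_fps[OF this] show ?thesis by (simp add: A)
  qed
  moreover have "F q = prodinf (\<lambda>n. (1 - q ^ Suc n) powr e)"
  proof -
    obtain s where s: "(\<lambda>i. ln (1 - q ^ Suc i)) sums s" "(\<lambda>n. fps_nth g n * q ^ n) sums (e * s)"
      using g_sums[OF q] by blast
    have "F q = exp (e * s)"
      using s(2) by (simp add: F_def eval_fps_def sums_iff)
    also have "\<dots> = prodinf (\<lambda>i. exp (e * ln (1 - q ^ Suc i)))"
      using prodinf_exp[OF sums_summable[OF sums_mult[OF s(1), of e]]] sums_unique[OF sums_mult[OF s(1), of e]]
      by simp
    \<comment> \<open>For a nonzero base \<open>powr\<close> is exp (e ln), so the branch is the
      principal one of \<open>eta_power\<close>.\<close>
    also have "(\<lambda>i. exp (e * ln (1 - q ^ Suc i))) = (\<lambda>n. (1 - q ^ Suc n) powr e)"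
    proof
      fix n
      have "norm (q ^ Suc n) < 1"
        using power_strict_mono[of "norm q" 1 "Suc n"] q by (simp add: norm_power del: power_Suc)
      then have "1 - q ^ Suc n \<noteq> 0" by (metis eq_iff_diff_eq_0 less_irrefl norm_one)
      then show "exp (e * ln (1 - q ^ Suc n)) = (1 - q ^ Suc n) powr e" by (simp only: powr_def if_False)
    qed
    finally show ?thesis .
  qed
  ultimately show ?thesis
    using norm_summable_imp_has_sum by metis
qed

section \<open>The trace function as a power of eta\<close>

theorem mainTheorem3:
  fixes c hU hW e :: complex
    and smulV :: "complex \<Rightarrow> 'v::ab_group_add \<Rightarrow> 'v"
    and smulU :: "complex \<Rightarrow> 'u::ab_group_add \<Rightarrow> 'u"
    and smulW :: "complex \<Rightarrow> 'w::ab_group_add \<Rightarrow> 'w"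
    and Y :: "'v \<Rightarrow> int \<Rightarrow> 'v \<Rightarrow> 'v" and vac \<omega> :: 'v
    and YU :: "'v \<Rightarrow> int \<Rightarrow> 'u \<Rightarrow> 'u" and YW :: "'v \<Rightarrow> int \<Rightarrow> 'w \<Rightarrow> 'w"
    and I :: "'u \<Rightarrow> complex \<Rightarrow> 'w \<Rightarrow> 'w" and u :: 'u and \<tau> :: complex
  assumes params: "(c, hU, hW, e) \<in>
      {(1/2, 1/2, 1/16, 1), (7/10, 1/10, 3/80, 1/5), (4/5, 2/5, 1/15, 4/5), (6/7, 1/7, 1/21, 2/7)}"
    and V: "vertex_operator_algebra smulV Y vac \<omega> c"
      "irreducible_highest_weight_module smulV c 0 (virasoro_mode Y \<omega>)"
    and U: "voa_module smulV Y vac \<omega> c smulU YU"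
      "irreducible_highest_weight_module smulU c hU (virasoro_mode YU \<omega>)"
    and W: "voa_module smulV Y vac \<omega> c smulW YW"
      "irreducible_highest_weight_module smulW c hW (virasoro_mode YW \<omega>)"
    and I: "intertwining_operator smulV Y vac \<omega> c smulU YU smulW YW I"
      "\<exists>w r x. I w r x \<noteq> 0"
    and u: "highest_weight_vector smulU hU (virasoro_mode YU \<omega>) u"
      "intertwining_operator.leading_coeff_one \<omega> smulU YU smulW YW I u"
    and \<tau>: "Im \<tau> > 0"
  shows "intertwining_operator.trace_function \<omega> c smulU YU smulW YW I u \<tau> = eta_power e \<tau>"
proof -
  interpret intertwining_operator smulV Y vac \<omega> c smulU YU smulW YW I by fact
  interpret WV: irreducible_highest_weight_module smulW c hW "virasoro_mode YW \<omega>" by fact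
  \<comment> \<open>Subtracting c/24 leaves hU/12 = e/24, the leading exponent of the eta
    power.\<close>
  define l where "l = c / 24 + hU / 12"
  have "c * (2 * hU + 1) = 2 * hU * (5 - 8 * hU) \<and> 2 * hU + 1 \<noteq> 0 \<and>
      e = 2 * hU"
    using params by (elim insertE emptyE Pair_inject; hypsubst; simp)
  then have c: "c * (2 * hU + 1) = 2 * hU * (5 - 8 * hU)" and h: "2 * hU + 1 \<noteq> 0"
    and e: "e = 2 * hU"
    by blast+
  interpret T: divisor_sum_recursion "trace_coeff u" l e
    unfolding l_def e
    by unfold_locales (rule trace_coeff_recursion[OF WV.virasoro_module_axioms U(2) u(1) c h])
  obtain \<kappa> where \<kappa>: "trace_coeff u \<kappa> = 1" "\<And>\<mu>. trace_coeff u \<mu> \<noteq> 0 \<Longrightarrow> \<mu> = \<kappa> \<or> Re \<kappa> < Re \<mu>"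
    using u(2) unfolding leading_coeff_one_def by blast
  define b where "b n = trace_coeff u (l + of_nat n)" for n
  define q where "q = exp (2 * of_real pi * \<i> * \<tau>)"
  define f where "f = (\<lambda>\<kappa>. trace_coeff u \<kappa> * exp (2 * of_real pi * \<i> * \<tau> * (\<kappa> - c / 24)))"
  let ?p = "exp (2 * of_real pi * \<i> * \<tau> * (e / 24))"
  have q_power: "q ^ n = exp (2 * of_real pi * \<i> * \<tau> * of_nat n)" for n
    unfolding q_def by (simp add: exp_of_nat_mult[symmetric] mult.commute)
  have "norm q < 1"
    using \<tau> by (simp add: q_def norm_exp_eq_Re)
  moreover have "b 0 = 1"
    using \<kappa>(1) T.leading_weight[OF \<kappa>] by (simp add: b_def)
  moreover have "of_nat n * b n = - e * (\<Sum>k=1..n. of_nat (divisor_sum k) * b (n - k))" for n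
    unfolding b_def by (rule T.coefficient_recursion)
  ultimately have "((\<lambda>n. b n * q ^ n) has_sum (prodinf (\<lambda>n. (1 - q ^ Suc n) powr e))) UNIV"
    by (intro prodinf_powr_has_sum)
  from has_sum_cmult_right[OF this, of ?p]
  have "((\<lambda>n. ?p * (b n * q ^ n)) has_sum eta_power e \<tau>) UNIV"
    unfolding eta_power_def q_power .
  also have "(\<lambda>n. ?p * (b n * q ^ n)) = (\<lambda>n. f (l + of_nat n))"
  proof
    fix n
    have "l + of_nat n - c / 24 = e / 24 + of_nat n" by (simp add: l_def e)
    then have "exp (2 * of_real pi * \<i> * \<tau> * (l + of_nat n - c / 24)) = ?p * q ^ n"
      by (simp only: q_power distrib_left exp_add)
    then show "?p * (b n * q ^ n) = f (l + of_nat n)"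
      unfolding f_def b_def by (simp only: mult_ac)
  qed
  finally have "(f has_sum eta_power e \<tau>) (range (\<lambda>n::nat. l + of_nat n))"
    by (subst has_sum_reindex) (auto simp: inj_on_def o_def)
  \<comment> \<open>\<open>T.support\<close> confines the nonzero terms to the weights l + n, so the
    sum over all complex \<kappa> is the power series.\<close>
  also have "?this \<longleftrightarrow> (f has_sum eta_power e \<tau>) UNIV"
    by (rule has_sum_cong_neutral) (auto simp: f_def elim: T.support)
  finally show ?thesis
    unfolding trace_function_def f_def by (rule infsumI)
qed

end
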